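(* Let $\Lambda$ be a realisation of the Ginibre ensemble on $\mathbb{C}$. Then almost surely the set of functions $\mathcal{E}_\Lambda=\{e_\lambda:\lambda\in\Lambda\}$, where $e_\lambda(z)=e^{\overline{\lambda}z}$, spans the Fock-Bargmann space. Equivalently, almost surely in $\Lambda$ the following holds: if $f$ is a function in the Fock-Bargmann space which vanishes at all the points of $\Lambda$, then $f\equiv 0$.
   Context: Let $\gamma$ be the standard complex Gaussian measure on $\mathbb{C}$, with density $\frac1\pi e^{-|z|^2}$ with respect to Lebesgue measure. The Fock-Bargmann space is the closure in $L^2(\gamma)$ of the set of polynomials in one complex variable $z$; its elements are (identified with) entire functions. A point process on a space $\Xi$ is determinantal with background measure $\mu$ and kernel $K:\Xi\times\Xi\to\mathbb{C}$ if for every $n\ge 1$ its $n$-point intensity function with respect to $\mu^{\otimes n}$ is $\rho_n(x_1,\dots,x_n)=\det\left(K(x_i,x_j)\right)_{i,j=1}^n$. The Ginibre ensemble is the determinantal point process on $\mathbb{C}$ with background measure $\gamma$ and kernel $K(z,w)=e^{z\overline{w}}$. A set of vectors spans a Hilbert space if its closed linear span is the whole space. *)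

theory Defs
  imports
    "HOL-Probability.Probability"
    "HOL-Complex_Analysis.Complex_Analysis"
    "HOL-Library.Function_Algebras"
    "Jordan_Normal_Form.Determinant"
begin

section \<open>Point processes and determinantal processes\<close>

text \<open>
  A point process is a random locally finite subset of the space (so it is simple);
  \<open>emeasure (count_space UNIV)\<close> counts points, with value \<open>\<infinity>\<close> on infinite sets.
\<close>

locale point_process = prob_space M
  for M :: "'w measure" and \<Lambda> :: "'w \<Rightarrow> 'a :: topological_space set" +
  assumes locally_finite: "\<omega> \<in> space M \<Longrightarrow> compact C \<Longrightarrow> finite (\<Lambda> \<omega> \<inter> C)"
    and measurable_count: "A \<in> sets borel \<Longrightarrow>
      (\<lambda>\<omega>. emeasure (count_space UNIV) (\<Lambda> \<omega> \<inter> A)) \<in> borel_measurable M"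

text \<open>
  Points of the \<open>n\<close>-fold product are functions on \<open>{..<n}\<close>. The \<open>n\<close>-point intensity function is
  the density, with respect to the \<open>n\<close>-fold product of \<open>\<mu>\<close>, of the \<open>n\<close>-th factorial moment measure,
  which maps \<open>B\<close> to the expected number of \<open>n\<close>-tuples of distinct points of \<open>\<Lambda>\<close> lying in \<open>B\<close>.
\<close>

definition n_point_intensity ::
  "'w measure \<Rightarrow> ('w \<Rightarrow> 'a set) \<Rightarrow> 'a measure \<Rightarrow> nat \<Rightarrow> ((nat \<Rightarrow> 'a) \<Rightarrow> real) \<Rightarrow> bool" where
  "n_point_intensity M \<Lambda> \<mu> n \<rho> \<longleftrightarrow>
     \<rho> \<in> borel_measurable (Pi\<^sub>M {..<n} (\<lambda>_. \<mu>)) \<and>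
     (\<forall>x \<in> space (Pi\<^sub>M {..<n} (\<lambda>_. \<mu>)). 0 \<le> \<rho> x) \<and>
     (\<forall>B \<in> sets (Pi\<^sub>M {..<n} (\<lambda>_. \<mu>)).
        (\<integral>\<^sup>+\<omega>. emeasure (count_space UNIV)
               {x \<in> B. (\<forall>i<n. x i \<in> \<Lambda> \<omega>) \<and> inj_on x {..<n}} \<partial>M)
        = (\<integral>\<^sup>+x. ennreal (\<rho> x) * indicator B x \<partial>(Pi\<^sub>M {..<n} (\<lambda>_. \<mu>))))"

text \<open>
  Intensity functions are densities, so they are only determined almost everywhere.
\<close>

definition determinantal_process ::
  "'w measure \<Rightarrow> ('w \<Rightarrow> 'a :: topological_space set) \<Rightarrow> 'a measure \<Rightarrow> ('a \<Rightarrow> 'a \<Rightarrow> complex) \<Rightarrow> bool"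
  where
  "determinantal_process M \<Lambda> \<mu> K \<longleftrightarrow>
     point_process M \<Lambda> \<and> sigma_finite_measure \<mu> \<and> sets \<mu> = sets borel \<and>
     (\<forall>n\<ge>1. \<exists>\<rho>. n_point_intensity M \<Lambda> \<mu> n \<rho> \<and>
        (AE x in Pi\<^sub>M {..<n} (\<lambda>_. \<mu>).
           complex_of_real (\<rho> x) = Determinant.det (Matrix.mat n n (\<lambda>(i, j). K (x i) (x j)))))"

definition complex_gaussian :: "complex measure" where
  "complex_gaussian = density lborel (\<lambda>z. ennreal (exp (- (cmod z)\<^sup>2) / pi))"

definition ginibre_ensemble :: "'w measure \<Rightarrow> ('w \<Rightarrow> complex set) \<Rightarrow> bool" where
  "ginibre_ensemble M \<Lambda> \<longleftrightarrow>
     determinantal_process M \<Lambda> complex_gaussian (\<lambda>z w. exp (z * cnj w))"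

section \<open>The Fock-Bargmann space\<close>

text \<open>
  Elements of \<open>L\<^sup>2\<close> are represented by square-integrable functions rather than by classes modulo
  almost everywhere equality; the sets \<open>L2_closure \<mu> S\<close> are closed under almost everywhere equality.
\<close>

definition L2_functions :: "'a measure \<Rightarrow> ('a \<Rightarrow> complex) set" where
  "L2_functions \<mu> = {f \<in> borel_measurable \<mu>. integrable \<mu> (\<lambda>x. (cmod (f x))\<^sup>2)}"

definition L2_norm :: "'a measure \<Rightarrow> ('a \<Rightarrow> complex) \<Rightarrow> real" where
  "L2_norm \<mu> f = sqrt (\<integral>x. (cmod (f x))\<^sup>2 \<partial>\<mu>)"

text \<open>
  Meant for \<open>S \<subseteq> L2_functions \<mu>\<close>. The explicit membership of \<open>g\<close> is a safeguard: the Bochner integral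
  in \<open>L2_norm\<close> would be \<open>0\<close> for a function that is not square-integrable.
\<close>

definition L2_closure :: "'a measure \<Rightarrow> ('a \<Rightarrow> complex) set \<Rightarrow> ('a \<Rightarrow> complex) set" where
  "L2_closure \<mu> S = {f \<in> L2_functions \<mu>.
     \<forall>\<epsilon>>0. \<exists>g \<in> S \<inter> L2_functions \<mu>. L2_norm \<mu> (\<lambda>x. f x - g x) < \<epsilon>}"

definition fock_bargmann :: "(complex \<Rightarrow> complex) set" where
  "fock_bargmann = L2_closure complex_gaussian (range poly)"

text \<open>
  Each almost everywhere class in \<open>fock_bargmann\<close> contains exactly one entire function, with which
  it is identified. Values at individual points are meaningful for this representative only.
\<close>

definition fock_bargmann_entire :: "(complex \<Rightarrow> complex) set" where
  "fock_bargmann_entire = {f \<in> fock_bargmann. f holomorphic_on UNIV}"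

definition exponentials :: "complex set \<Rightarrow> (complex \<Rightarrow> complex) set" where
  "exponentials A = {\<lambda>z. exp (cnj l * z) | l. l \<in> A}"

lemma vector_space_complex_functions:
  "vector_space (\<lambda>(c :: complex) (f :: 'a \<Rightarrow> complex) z. c * f z)"
  by unfold_locales (auto simp: fun_eq_iff algebra_simps)

definition spans_fock_bargmann :: "(complex \<Rightarrow> complex) set \<Rightarrow> bool" where
  "spans_fock_bargmann E \<longleftrightarrow>
     L2_closure complex_gaussian (module.span (\<lambda>c f z. c * f z) E) = fock_bargmann"

end

theory Submission
  imports Defs
begin

text \<open>
  If \<open>f\<close> is entire and vanishes on \<open>\<Lambda>\<close>, with \<open>f 0 \<noteq> 0\<close>, then Jensen's inequality on the circle of
  radius \<open>r\<close> bounds the mean of \<open>\<bar>f\<bar>\<^sup>2\<close> from below by \<open>\<bar>f 0\<bar>\<^sup>2 \<Prod> r\<^sup>2 / \<bar>l\<bar>\<^sup>2\<close>, the product running over the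
  points \<open>l\<close> of \<open>\<Lambda>\<close> in the disc. Integrating over the annuli \<open>n \<le> \<bar>z\<bar>\<^sup>2 < n + 1\<close>, which have equal area,
  a nonzero \<open>f\<close> in the Fock-Bargmann space forces \<open>\<Sum>\<^sub>n exp (S\<^sub>n - n) < \<infinity>\<close>, where \<open>S\<^sub>n\<close> is the linear
  statistic of \<open>log\<^sup>+ (n / max 1 \<bar>z\<bar>\<^sup>2)\<close>. For the Ginibre ensemble \<open>S\<^sub>n\<close> has mean \<open>n - 1\<close>, and because
  of the determinantal repulsion its variance is only \<open>O(log n)\<close>. By Chebyshev's inequality
  \<open>exp (S\<^sub>n - n) \<ge> 1 / n\<close> with probability tending to \<open>1\<close>, so the series diverges almost surely.
  Completeness of the exponentials follows from uniqueness by minimizing the distance to their span;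
  the pointwise bound on the Fock-Bargmann space replaces completeness of \<open>L\<^sup>2\<close>.
\<close>

section \<open>Normalized area and the Gaussian measure\<close>

lemma distr_lborel_Complex:
  "distr (lborel \<Otimes>\<^sub>M lborel) borel (\<lambda>(x, y). Complex x y) = (lborel :: complex measure)"
proof (rule lborel_eqI[symmetric])
  have [measurable]: "(\<lambda>(x, y). Complex x y) \<in> borel_measurable (borel \<Otimes>\<^sub>M borel)"
    unfolding Complex_eq case_prod_beta by measurable
  fix l u :: complex
  assume le: "\<And>b. b \<in> Basis \<Longrightarrow> l \<bullet> b \<le> u \<bullet> b"
  have l1: "Re l \<le> Re u" "Im l \<le> Im u"
    using le[of 1] le[of \<i>] by (auto simp: Basis_complex_def inner_complex_def)
  have "emeasure (distr (lborel \<Otimes>\<^sub>M lborel) borel (\<lambda>(x, y). Complex x y)) (box l u)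
      = emeasure (lborel \<Otimes>\<^sub>M lborel) ({Re l<..<Re u} \<times> {Im l<..<Im u})"
    by (subst emeasure_distr)
       (auto simp: space_pair_measure box_def Basis_complex_def inner_complex_def intro!: arg_cong2[where f=emeasure])
  also have "\<dots> = ennreal ((Re u - Re l) * (Im u - Im l))"
    using l1 by (subst lborel.emeasure_pair_measure_Times) (auto simp: ennreal_mult)
  finally show "emeasure (distr (lborel \<Otimes>\<^sub>M lborel) borel (\<lambda>(x, y). Complex x y)) (box l u)
      = (\<Prod>b\<in>Basis. (u - l) \<bullet> b)"
    by (simp add: Basis_complex_def inner_complex_def)
qed simp

lemma nn_integral_lborel_Complex:
  assumes [measurable]: "F \<in> borel_measurable borel"
  shows "(\<integral>\<^sup>+z. F z \<partial>lborel) = (\<integral>\<^sup>+x. \<integral>\<^sup>+y. F (Complex x y) \<partial>lborel \<partial>lborel)"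
proof -
  have [measurable]: "(\<lambda>(x, y). Complex x y) \<in> borel_measurable (borel \<Otimes>\<^sub>M borel)"
    unfolding Complex_eq case_prod_beta by measurable
  have "(\<integral>\<^sup>+z. F z \<partial>lborel) = (\<integral>\<^sup>+z. F z \<partial>distr (lborel \<Otimes>\<^sub>M lborel) borel (\<lambda>(x, y). Complex x y))"
    by (simp add: distr_lborel_Complex)
  also have "\<dots> = (\<integral>\<^sup>+p. F (case p of (x, y) \<Rightarrow> Complex x y) \<partial>(lborel \<Otimes>\<^sub>M lborel))"
    by (rule nn_integral_distr) auto
  also have "\<dots> = (\<integral>\<^sup>+x. \<integral>\<^sup>+y. F (Complex x y) \<partial>lborel \<partial>lborel)"
    by (subst lborel.nn_integral_fst[symmetric]) auto
  finally show ?thesis .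
qed

lemma nn_integral_lborel_translate:
  fixes F :: "'a :: euclidean_space \<Rightarrow> ennreal"
  assumes [measurable]: "F \<in> borel_measurable borel"
  shows "(\<integral>\<^sup>+z. F (a + z) \<partial>lborel) = (\<integral>\<^sup>+z. F z \<partial>lborel)"
proof -
  have "(\<integral>\<^sup>+z. F z \<partial>lborel) = (\<integral>\<^sup>+z. F z \<partial>distr lborel borel ((+) a))"
    by (simp add: lborel_distr_plus)
  also have "\<dots> = (\<integral>\<^sup>+z. F (a + z) \<partial>lborel)"
    by (subst nn_integral_distr) auto
  finally show ?thesis ..
qed

lemma nn_integral_lborel_shear_Im:
  assumes [measurable]: "F \<in> borel_measurable borel"
  shows "(\<integral>\<^sup>+z. F (z + \<i> * of_real (a * Re z)) \<partial>lborel) = (\<integral>\<^sup>+z. F z \<partial>lborel)"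
proof -
  have [measurable]: "(\<lambda>y. F (Complex x y)) \<in> borel_measurable borel" for x
    unfolding Complex_eq by measurable
  have "(\<integral>\<^sup>+z. F (z + \<i> * of_real (a * Re z)) \<partial>lborel)
      = (\<integral>\<^sup>+x. \<integral>\<^sup>+y. F (Complex x (a * x + y)) \<partial>lborel \<partial>lborel)"
    by (subst nn_integral_lborel_Complex) (auto simp: Complex_eq algebra_simps)
  also have "\<dots> = (\<integral>\<^sup>+x. \<integral>\<^sup>+y. F (Complex x y) \<partial>lborel \<partial>lborel)"
    by (subst nn_integral_lborel_translate[of "\<lambda>y. F (Complex _ y)"]) auto
  finally show ?thesis by (simp add: nn_integral_lborel_Complex)
qed

lemma nn_integral_lborel_shear_Re:
  assumes [measurable]: "F \<in> borel_measurable borel"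
  shows "(\<integral>\<^sup>+z. F (z + of_real (a * Im z)) \<partial>lborel) = (\<integral>\<^sup>+z. F z \<partial>lborel)"
proof -
  have [measurable]: "(\<lambda>x. F (Complex x y)) \<in> borel_measurable borel" for y
    unfolding Complex_eq by measurable
  have [measurable]: "(\<lambda>(x, y). F (Complex x y)) \<in> borel_measurable (borel \<Otimes>\<^sub>M borel)"
    unfolding Complex_eq case_prod_beta by measurable
  have [measurable]: "(\<lambda>(x, y). F (Complex (a * y + x) y)) \<in> borel_measurable (borel \<Otimes>\<^sub>M borel)"
    unfolding Complex_eq case_prod_beta by measurable
  have "(\<integral>\<^sup>+z. F (z + of_real (a * Im z)) \<partial>lborel)
      = (\<integral>\<^sup>+x. \<integral>\<^sup>+y. F (Complex (a * y + x) y) \<partial>lborel \<partial>lborel)"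
    by (subst nn_integral_lborel_Complex) (auto simp: Complex_eq algebra_simps)
  also have "\<dots> = (\<integral>\<^sup>+y. \<integral>\<^sup>+x. F (Complex (a * y + x) y) \<partial>lborel \<partial>lborel)"
    by (rule lborel_pair.Fubini'[symmetric]) simp
  also have "\<dots> = (\<integral>\<^sup>+y. \<integral>\<^sup>+x. F (Complex x y) \<partial>lborel \<partial>lborel)"
    by (subst nn_integral_lborel_translate[of "\<lambda>x. F (Complex x _)"]) auto
  also have "\<dots> = (\<integral>\<^sup>+x. \<integral>\<^sup>+y. F (Complex x y) \<partial>lborel \<partial>lborel)"
    by (rule lborel_pair.Fubini') simp
  finally show ?thesis by (simp add: nn_integral_lborel_Complex)
qed

text \<open>A rotation by an angle \<open>t\<close> other than \<open>\<pi>\<close> is a product of three shears with parameters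
  \<open>- tan (t/2)\<close>, \<open>sin t\<close>, \<open>- tan (t/2)\<close>; here \<open>tan (t/2) = sin t / (1 + cos t)\<close>.\<close>

lemma nn_integral_lborel_rotate:
  fixes c :: complex
  assumes [measurable]: "F \<in> borel_measurable borel" and c: "cmod c = 1"
  shows "(\<integral>\<^sup>+z. F (c * z) \<partial>lborel) = (\<integral>\<^sup>+z. F z \<partial>lborel)"
proof -
  have main: "(\<integral>\<^sup>+z. F (c * z) \<partial>lborel) = (\<integral>\<^sup>+z. F z \<partial>lborel)"
    if [measurable]: "F \<in> borel_measurable borel" and c: "cmod c = 1" "c \<noteq> -1" for F and c :: complex
  proof -
    define t where "t = - (Im c / (1 + Re c))"
    define s where "s = Im c"
    have sq: "(Re c)\<^sup>2 + (Im c)\<^sup>2 = 1"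
      using c cmod_power2[of c] by simp
    have "Re c \<noteq> -1"
    proof
      assume "Re c = -1"
      with sq have "Im c = 0" by simp
      with \<open>Re c = -1\<close> c show False by (simp add: complex_eq_iff)
    qed
    then have ne: "1 + Re c \<noteq> 0" by simp
    let ?A = "\<lambda>z. z + of_real (t * Im z)" and ?B = "\<lambda>z. z + \<i> * of_real (s * Re z)"
    have 1: "1 + t * s = Re c"
      using sq ne unfolding t_def s_def by (simp add: field_simps power2_eq_square)
    have "t * (1 + Re c) = - Im c"
      using ne by (simp add: t_def)
    then have 2: "t + t * (1 + t * s) = - Im c"
      unfolding 1 by (simp add: algebra_simps)
    have rot: "?A (?B (?A z)) = c * z" for z
    proof -
      have "Re (?A (?B (?A z))) = (1 + t * s) * Re z + (t + t * (1 + t * s)) * Im z"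
        by (simp add: algebra_simps)
      moreover have "Im (?A (?B (?A z))) = s * Re z + (1 + t * s) * Im z"
        by (simp add: algebra_simps)
      ultimately show ?thesis
        unfolding 2 unfolding 1 by (simp add: complex_eq_iff s_def)
    qed
    have "(\<integral>\<^sup>+z. F (c * z) \<partial>lborel) = (\<integral>\<^sup>+z. F (?A (?B (?A z))) \<partial>lborel)"
      by (simp only: rot)
    also have "\<dots> = (\<integral>\<^sup>+z. F (?A (?B z)) \<partial>lborel)"
      by (subst nn_integral_lborel_shear_Re[of "\<lambda>z. F (?A (?B z))"]) simp_all
    also have "\<dots> = (\<integral>\<^sup>+z. F (?A z) \<partial>lborel)"
      by (subst nn_integral_lborel_shear_Im[of "\<lambda>z. F (?A z)"]) simp_all
    also have "\<dots> = (\<integral>\<^sup>+z. F z \<partial>lborel)"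
      by (rule nn_integral_lborel_shear_Re) simp
    finally show ?thesis .
  qed
  show ?thesis
  proof (cases "c = -1")
    case True
    have "(\<integral>\<^sup>+z. F (c * z) \<partial>lborel) = (\<integral>\<^sup>+z. F (\<i> * (\<i> * z)) \<partial>lborel)"
      by (simp add: True mult.assoc[symmetric])
    also have "\<dots> = (\<integral>\<^sup>+z. F (\<i> * z) \<partial>lborel)"
      by (subst main[of "\<lambda>z. F (\<i> * z)" \<i>]) (auto simp: complex_eq_iff)
    also have "\<dots> = (\<integral>\<^sup>+z. F z \<partial>lborel)"
      by (rule main) (auto simp: complex_eq_iff)
    finally show ?thesis .
  qed (use main c in auto)
qed

definition plane_measure :: "complex measure" where
  "plane_measure = density lborel (\<lambda>_. ennreal (1 / pi))"

lemma sets_plane_measure [measurable_cong, simp]: "sets plane_measure = sets borel"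
  and space_plane_measure [simp]: "space plane_measure = UNIV"
  by (auto simp: plane_measure_def)

lemma nn_integral_plane_measure:
  assumes [measurable]: "F \<in> borel_measurable borel"
  shows "(\<integral>\<^sup>+z. F z \<partial>plane_measure) = ennreal (1 / pi) * (\<integral>\<^sup>+z. F z \<partial>lborel)"
  unfolding plane_measure_def by (subst nn_integral_density) (auto simp: nn_integral_cmult)

lemma sigma_finite_plane_measure: "sigma_finite_measure plane_measure"
  unfolding plane_measure_def
  by (subst sigma_finite_measure.sigma_finite_iff_density_finite[OF sigma_finite_lborel]) auto

interpretation plane: sigma_finite_measure plane_measure
  by (rule sigma_finite_plane_measure)

interpretation plane_pair: pair_sigma_finite plane_measure plane_measure ..

lemma nn_integral_plane_translate:
  assumes [measurable]: "F \<in> borel_measurable borel"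
  shows "(\<integral>\<^sup>+z. F (a + z) \<partial>plane_measure) = (\<integral>\<^sup>+z. F z \<partial>plane_measure)"
  by (simp add: nn_integral_plane_measure nn_integral_lborel_translate)

lemma nn_integral_plane_rotate:
  assumes [measurable]: "F \<in> borel_measurable borel" and "cmod c = 1"
  shows "(\<integral>\<^sup>+z. F (c * z) \<partial>plane_measure) = (\<integral>\<^sup>+z. F z \<partial>plane_measure)"
  using assms by (simp add: nn_integral_plane_measure nn_integral_lborel_rotate)

lemma emeasure_plane_disc:
  "emeasure plane_measure {z. (cmod z)\<^sup>2 < t} = ennreal t"
proof (cases "t > 0")
  case True
  have "{z. (cmod z)\<^sup>2 < t} = ball 0 (sqrt t)"
    unfolding ball_def by (auto simp flip: real_sqrt_less_iff[of "(cmod _)\<^sup>2"])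
  moreover have "emeasure plane_measure (ball 0 (sqrt t)) = ennreal (1 / pi) * emeasure lborel (ball 0 (sqrt t) :: complex set)"
    unfolding plane_measure_def by (subst emeasure_density) (auto simp: nn_integral_cmult_indicator)
  ultimately show ?thesis using True
    by (simp add: emeasure_ball unit_ball_vol_2 ennreal_mult[symmetric])
next
  case False
  then have "{z. (cmod z)\<^sup>2 < t} = {}"
    by (auto simp: not_less) (meson le_less_trans not_le zero_le_power2)
  then show ?thesis using False by (simp add: ennreal_neg)
qed

lemma emeasure_plane_annulus:
  assumes "0 \<le> s" "s \<le> t"
  shows "emeasure plane_measure {z. s \<le> (cmod z)\<^sup>2 \<and> (cmod z)\<^sup>2 < t} = ennreal (t - s)"
proof -
  have "emeasure plane_measure {z. s \<le> (cmod z)\<^sup>2 \<and> (cmod z)\<^sup>2 < t}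
      = emeasure plane_measure ({z. (cmod z)\<^sup>2 < t} - {z. (cmod z)\<^sup>2 < s})"
    by (rule arg_cong[where f = "emeasure plane_measure"]) auto
  also have "\<dots> = emeasure plane_measure {z. (cmod z)\<^sup>2 < t} - emeasure plane_measure {z. (cmod z)\<^sup>2 < s}"
    by (rule emeasure_Diff) (use assms in \<open>auto simp: emeasure_plane_disc\<close>)
  finally show ?thesis using assms by (simp add: emeasure_plane_disc ennreal_minus)
qed

lemma nn_integral_plane_layer_cake:
  assumes [measurable]: "f \<in> borel_measurable borel"
  shows "(\<integral>\<^sup>+z. (\<integral>\<^sup>+t. f t * indicator {(cmod z)\<^sup>2<..} t \<partial>lborel) \<partial>plane_measure) =
    (\<integral>\<^sup>+t. f t * ennreal t \<partial>lborel)"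
proof -
  interpret pair_sigma_finite plane_measure lborel ..
  have [measurable]: "Measurable.pred (borel \<Otimes>\<^sub>M borel) (\<lambda>p. (cmod (fst p))\<^sup>2 < snd p)"
    by measurable
  have "(\<integral>\<^sup>+z. (\<integral>\<^sup>+t. f t * indicator {(cmod z)\<^sup>2<..} t \<partial>lborel) \<partial>plane_measure)
    = (\<integral>\<^sup>+z. (\<integral>\<^sup>+t. f t * indicator {p. (cmod (fst p))\<^sup>2 < snd p} (z, t) \<partial>lborel) \<partial>plane_measure)"
    by (intro nn_integral_cong) (auto split: split_indicator)
  also have "\<dots> = (\<integral>\<^sup>+t. (\<integral>\<^sup>+z. f t * indicator {p. (cmod (fst p))\<^sup>2 < snd p} (z, t) \<partial>plane_measure) \<partial>lborel)"
    by (rule Fubini'[symmetric]) simp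
  also have "\<dots> = (\<integral>\<^sup>+t. (\<integral>\<^sup>+z. f t * indicator {z. (cmod z)\<^sup>2 < t} z \<partial>plane_measure) \<partial>lborel)"
    by (intro nn_integral_cong) (auto split: split_indicator)
  also have "\<dots> = (\<integral>\<^sup>+t. f t * ennreal t \<partial>lborel)"
    by (subst nn_integral_cmult_indicator) (auto simp: emeasure_plane_disc)
  finally show ?thesis .
qed

lemma nn_integral_exp_atLeast:
  assumes "a > 0"
  shows "(\<integral>\<^sup>+t. ennreal (a * exp (- a * t)) * indicator {s<..} t \<partial>lborel) = ennreal (exp (- a * s))"
proof -
  have "(\<integral>\<^sup>+t. ennreal (a * exp (- a * t)) * indicator {s<..} t \<partial>lborel)
    = (\<integral>\<^sup>+t. ennreal (a * exp (- a * t)) * indicator {s..} t \<partial>lborel)"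
    using AE_lborel_singleton[of s] by (intro nn_integral_cong_AE) (auto split: split_indicator)
  also have "\<dots> = ennreal (0 - (- exp (- a * s)))"
  proof (rule nn_integral_FTC_atLeast)
    show "((\<lambda>x. - exp (- a * x)) \<longlongrightarrow> 0) at_top"
      using assms by real_asymp
  qed (use assms in \<open>auto intro!: derivative_eq_intros\<close>)
  finally show ?thesis by simp
qed

lemma nn_integral_plane_gaussian:
  assumes "a > 0"
  shows "(\<integral>\<^sup>+z. ennreal (exp (- a * (cmod z)\<^sup>2)) \<partial>plane_measure) = ennreal (1 / a)"
proof -
  have "(\<integral>\<^sup>+z. ennreal (exp (- a * (cmod z)\<^sup>2)) \<partial>plane_measure)
    = (\<integral>\<^sup>+t. ennreal (a * exp (- a * t)) * ennreal t \<partial>lborel)"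
    by (subst nn_integral_exp_atLeast[OF assms, symmetric], rule nn_integral_plane_layer_cake) simp
  also have "\<dots> = (\<integral>\<^sup>+t. ennreal (a * exp (- a * t) * t) * indicator {0..} t \<partial>lborel)"
    using assms by (intro nn_integral_cong) (auto split: split_indicator simp: ennreal_mult'' ennreal_neg)
  also have "\<dots> = ennreal (0 - (- (0 + 1 / a) * exp (- a * 0)))"
  proof (rule nn_integral_FTC_atLeast)
    show "((\<lambda>x. - (x + 1 / a) * exp (- a * x)) \<longlongrightarrow> 0) at_top"
      using assms by real_asymp
    show "DERIV (\<lambda>x. - (x + 1 / a) * exp (- a * x)) x :> a * exp (- a * x) * x" for x
      using assms by (auto intro!: derivative_eq_intros simp: field_simps)
  qed (use assms in auto)
  finally show ?thesis by simp
qed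

lemma complex_gaussian_plane:
  "complex_gaussian = density plane_measure (\<lambda>z. ennreal (exp (- (cmod z)\<^sup>2)))"
  unfolding complex_gaussian_def plane_measure_def
  by (subst density_density_eq) (auto intro!: density_cong simp: ennreal_mult''[symmetric] field_simps)

lemma sets_complex_gaussian [measurable_cong, simp]: "sets complex_gaussian = sets borel"
  and space_complex_gaussian [simp]: "space complex_gaussian = UNIV"
  by (auto simp: complex_gaussian_def)

lemma nn_integral_complex_gaussian:
  assumes [measurable]: "F \<in> borel_measurable borel"
  shows "(\<integral>\<^sup>+z. F z \<partial>complex_gaussian) = (\<integral>\<^sup>+z. ennreal (exp (- (cmod z)\<^sup>2)) * F z \<partial>plane_measure)"
  unfolding complex_gaussian_plane by (rule nn_integral_density) auto

lemma prob_space_complex_gaussian: "prob_space complex_gaussian"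
proof
  have "emeasure complex_gaussian UNIV = (\<integral>\<^sup>+z. 1 \<partial>complex_gaussian)"
    by simp
  also have "\<dots> = 1"
    using nn_integral_plane_gaussian[of 1] by (subst nn_integral_complex_gaussian) auto
  finally show "emeasure complex_gaussian (space complex_gaussian) = 1" by simp
qed

interpretation gaussian: prob_space complex_gaussian
  by (rule prob_space_complex_gaussian)

lemma distr_complex_gaussian_rotate:
  assumes "cmod c = 1"
  shows "distr complex_gaussian borel ((*) c) = complex_gaussian"
proof (rule measure_eqI)
  fix A assume "A \<in> sets (distr complex_gaussian borel ((*) c))"
  then have [measurable]: "A \<in> sets borel" by simp
  have "emeasure (distr complex_gaussian borel ((*) c)) A = (\<integral>\<^sup>+z. indicator A z \<partial>distr complex_gaussian borel ((*) c))"
    by simp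
  also have "\<dots> = (\<integral>\<^sup>+z. indicator A (c * z) \<partial>complex_gaussian)"
    by (subst nn_integral_distr) auto
  also have "\<dots> = (\<integral>\<^sup>+z. ennreal (exp (- (cmod (c * z))\<^sup>2)) * indicator A (c * z) \<partial>plane_measure)"
    using assms by (subst nn_integral_complex_gaussian) (auto simp: norm_mult)
  also have "\<dots> = (\<integral>\<^sup>+z. ennreal (exp (- (cmod z)\<^sup>2)) * indicator A z \<partial>plane_measure)"
    using assms by (subst nn_integral_plane_rotate[of "\<lambda>z. ennreal (exp (- (cmod z)\<^sup>2)) * indicator A z"]) auto
  also have "\<dots> = emeasure complex_gaussian A"
    by (subst nn_integral_complex_gaussian[symmetric]) auto
  finally show "emeasure (distr complex_gaussian borel ((*) c)) A = emeasure complex_gaussian A" .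
qed simp

section \<open>Entire functions with prescribed zeros\<close>

definition unit_interval :: "real measure" where
  "unit_interval = density lborel (\<lambda>t. ennreal (indicator {0..1} t))"

lemma sets_unit_interval [measurable_cong, simp]: "sets unit_interval = sets borel"
  and space_unit_interval [simp]: "space unit_interval = UNIV"
  by (auto simp: unit_interval_def)

interpretation unit_interval: prob_space unit_interval
proof
  show "emeasure unit_interval (space unit_interval) = 1"
    by (simp add: unit_interval_def emeasure_density ennreal_indicator)
qed

interpretation gaussian_interval: pair_sigma_finite complex_gaussian unit_interval ..

lemma continuous_on_cis_path: "continuous_on A (\<lambda>t. cis (2 * pi * t))"
  by (intro continuous_intros)

lemma borel_measurable_cis_path [measurable]: "(\<lambda>t. cis (2 * pi * t)) \<in> borel_measurable borel"
  by (intro borel_measurable_continuous_onI continuous_on_cis_path)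

lemma borel_measurable_entire:
  "f holomorphic_on UNIV \<Longrightarrow> f \<in> borel_measurable borel"
  by (intro borel_measurable_continuous_onI holomorphic_on_imp_continuous_on)

lemma circle_mean_entire:
  assumes h: "h holomorphic_on UNIV"
  shows "integrable unit_interval (\<lambda>t. h (w * cis (2 * pi * t)))"
    and "(\<integral>t. h (w * cis (2 * pi * t)) \<partial>unit_interval) = h 0"
proof -
  let ?g = "\<lambda>t::real. h (w * cis (2 * pi * t))"
  have cont: "continuous_on A ?g" for A
    by (intro continuous_on_compose2[OF holomorphic_on_imp_continuous_on[OF h]] continuous_intros) auto
  then have [measurable]: "?g \<in> borel_measurable borel"
    by (intro borel_measurable_continuous_onI)
  have si: "set_integrable lborel {0..1} ?g"
    by (intro borel_integrable_atLeastAtMost' cont)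
  then show "integrable unit_interval ?g"
    unfolding unit_interval_def set_integrable_def by (subst integrable_density) auto
  have hw: "(\<lambda>u. h (w * u)) holomorphic_on cball 0 1"
    by (intro holomorphic_on_compose_gen[OF _ h, unfolded o_def] holomorphic_intros) auto
  have "((\<lambda>u. h (w * u) / (u - 0)) has_contour_integral (2 * of_real pi * \<i> * h (w * 0))) (circlepath 0 1)"
    by (rule Cauchy_integral_circlepath_simple[OF hw]) simp
  then have "((\<lambda>t. h (w * circlepath 0 1 t) / circlepath 0 1 t * vector_derivative (circlepath 0 1) (at t within {0..1}))
      has_integral (2 * of_real pi * \<i> * h 0)) {0..1}"
    by (simp add: has_contour_integral_def)
  then have "((\<lambda>t. 2 * of_real pi * \<i> * ?g t) has_integral (2 * of_real pi * \<i> * h 0)) {0..1}"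
  proof (rule has_integral_eq[rotated])
    fix t :: real assume t: "t \<in> {0..1}"
    have e: "cis (2 * pi * t) = exp (2 * of_real pi * \<i> * of_real t)"
      by (simp add: cis_conv_exp algebra_simps)
    show "h (w * circlepath 0 1 t) / circlepath 0 1 t * vector_derivative (circlepath 0 1) (at t within {0..1})
      = 2 * of_real pi * \<i> * ?g t"
      using t unfolding e by (subst vector_derivative_circlepath01) (auto simp: circlepath)
  qed
  then have "((\<lambda>t. inverse (2 * of_real pi * \<i>) * (2 * of_real pi * \<i> * ?g t)) has_integral
      (inverse (2 * of_real pi * \<i>) * (2 * of_real pi * \<i> * h 0))) {0..1}"
    by (rule has_integral_mult_right)
  then have "(?g has_integral h 0) {0..1}" by (simp add: field_simps)
  then have "integral {0..1} ?g = h 0" by (rule integral_unique)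
  then have "(LINT t:{0..1}|lborel. ?g t) = h 0"
    using set_borel_integral_eq_integral(2)[OF si] by simp
  then show "(\<integral>t. ?g t \<partial>unit_interval) = h 0"
    unfolding unit_interval_def set_lebesgue_integral_def by (subst integral_density) auto
qed

lemma circle_submean_entire:
  assumes h: "h holomorphic_on UNIV"
  shows "ennreal ((cmod (h 0))\<^sup>2) \<le> (\<integral>\<^sup>+t. ennreal ((cmod (h (w * cis (2 * pi * t))))\<^sup>2) \<partial>unit_interval)"
proof -
  note [measurable] = borel_measurable_entire[OF h]
  let ?g = "\<lambda>t::real. h (w * cis (2 * pi * t))"
  have "ennreal (cmod (h 0)) \<le> (\<integral>\<^sup>+t. ennreal (cmod (?g t)) \<partial>unit_interval)"
    using integral_norm_bound_ennreal[OF circle_mean_entire(1)[OF h]] circle_mean_entire(2)[OF h] by simp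
  then have "(ennreal (cmod (h 0)))\<^sup>2 \<le> (\<integral>\<^sup>+t. ennreal (cmod (?g t)) * 1 \<partial>unit_interval)\<^sup>2"
    by (intro power_mono) auto
  also have "\<dots> \<le> (\<integral>\<^sup>+t. (ennreal (cmod (?g t)))\<^sup>2 \<partial>unit_interval) * (\<integral>\<^sup>+t. 1\<^sup>2 \<partial>unit_interval)"
    by (rule Cauchy_Schwarz_nn_integral) auto
  finally show ?thesis using unit_interval.emeasure_space_1 by (simp add: ennreal_power)
qed

lemma gaussian_circle_average:
  fixes F :: "complex \<Rightarrow> ennreal"
  assumes [measurable]: "F \<in> borel_measurable borel"
  shows "(\<integral>\<^sup>+z. F z \<partial>complex_gaussian) = (\<integral>\<^sup>+z. \<integral>\<^sup>+t. F (z * cis (2 * pi * t)) \<partial>unit_interval \<partial>complex_gaussian)"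
proof -
  have "(\<integral>\<^sup>+z. \<integral>\<^sup>+t. F (z * cis (2 * pi * t)) \<partial>unit_interval \<partial>complex_gaussian)
    = (\<integral>\<^sup>+t. \<integral>\<^sup>+z. F (z * cis (2 * pi * t)) \<partial>complex_gaussian \<partial>unit_interval)"
    by (rule gaussian_interval.Fubini'[symmetric]) simp
  also have "\<dots> = (\<integral>\<^sup>+t. \<integral>\<^sup>+z. F z \<partial>complex_gaussian \<partial>unit_interval)"
  proof (rule nn_integral_cong)
    fix t
    have "(\<integral>\<^sup>+z. F z \<partial>complex_gaussian) = (\<integral>\<^sup>+z. F z \<partial>distr complex_gaussian borel ((*) (cis (2 * pi * t))))"
      by (simp add: distr_complex_gaussian_rotate)
    also have "\<dots> = (\<integral>\<^sup>+z. F (cis (2 * pi * t) * z) \<partial>complex_gaussian)"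
      by (rule nn_integral_distr) auto
    finally show "(\<integral>\<^sup>+z. F (z * cis (2 * pi * t)) \<partial>complex_gaussian) = (\<integral>\<^sup>+z. F z \<partial>complex_gaussian)"
      by (simp add: mult.commute)
  qed
  finally show ?thesis using unit_interval.emeasure_space_1 by simp
qed

lemma integral_gaussian_entire:
  assumes h: "h holomorphic_on UNIV" and int: "integrable complex_gaussian h"
  shows "(\<integral>z. h z \<partial>complex_gaussian) = h 0"
proof -
  note [measurable] = borel_measurable_entire[OF h]
  have rot: "integrable complex_gaussian (\<lambda>z. h (z * cis (2 * pi * t)))"
    "(\<integral>z. h (z * cis (2 * pi * t)) \<partial>complex_gaussian) = (\<integral>z. h z \<partial>complex_gaussian)" for t
  proof -
    have "integrable (distr complex_gaussian borel ((*) (cis (2 * pi * t)))) h"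
      using int by (simp add: distr_complex_gaussian_rotate)
    then have "integrable complex_gaussian (\<lambda>z. h (cis (2 * pi * t) * z))"
      by (subst (asm) integrable_distr_eq) auto
    then show "integrable complex_gaussian (\<lambda>z. h (z * cis (2 * pi * t)))" by (simp add: mult.commute)
    have "(\<integral>z. h z \<partial>complex_gaussian) = (\<integral>z. h z \<partial>distr complex_gaussian borel ((*) (cis (2 * pi * t))))"
      by (simp add: distr_complex_gaussian_rotate)
    also have "\<dots> = (\<integral>z. h (cis (2 * pi * t) * z) \<partial>complex_gaussian)"
      by (rule integral_distr) auto
    finally show "(\<integral>z. h (z * cis (2 * pi * t)) \<partial>complex_gaussian) = (\<integral>z. h z \<partial>complex_gaussian)"
      by (simp add: mult.commute)
  qed
  have fin: "(\<integral>\<^sup>+z. ennreal (cmod (h z)) \<partial>complex_gaussian) < \<infinity>"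
    using int by (simp add: integrable_iff_bounded)
  have I: "integrable (complex_gaussian \<Otimes>\<^sub>M unit_interval) (\<lambda>(z, t). h (z * cis (2 * pi * t)))"
  proof (rule integrableI_bounded)
    show "(\<lambda>(z, t). h (z * cis (2 * pi * t))) \<in> borel_measurable (complex_gaussian \<Otimes>\<^sub>M unit_interval)"
      by measurable
    have "(\<integral>\<^sup>+p. ennreal (norm (case p of (z, t) \<Rightarrow> h (z * cis (2 * pi * t)))) \<partial>(complex_gaussian \<Otimes>\<^sub>M unit_interval))
      = (\<integral>\<^sup>+z. \<integral>\<^sup>+t. ennreal (cmod (h (z * cis (2 * pi * t)))) \<partial>unit_interval \<partial>complex_gaussian)"
      by (subst unit_interval.nn_integral_fst[symmetric]) (auto simp: case_prod_beta)
    also have "\<dots> = (\<integral>\<^sup>+z. ennreal (cmod (h z)) \<partial>complex_gaussian)"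
      by (rule gaussian_circle_average[symmetric]) simp
    finally show "(\<integral>\<^sup>+p. ennreal (norm (case p of (z, t) \<Rightarrow> h (z * cis (2 * pi * t)))) \<partial>(complex_gaussian \<Otimes>\<^sub>M unit_interval)) < \<infinity>"
      using fin by simp
  qed
  have "(\<integral>z. h z \<partial>complex_gaussian) = (\<integral>t. \<integral>z. h (z * cis (2 * pi * t)) \<partial>complex_gaussian \<partial>unit_interval)"
    using unit_interval.prob_space by (simp add: rot)
  also have "\<dots> = (\<integral>z. \<integral>t. h (z * cis (2 * pi * t)) \<partial>unit_interval \<partial>complex_gaussian)"
    by (rule gaussian_interval.Fubini_integral[OF I])
  also have "\<dots> = h 0"
    using gaussian.prob_space by (simp add: circle_mean_entire[OF h])
  finally show ?thesis .
qed

lemma entire_factor_zero: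
  assumes f: "f holomorphic_on UNIV" and "f a = 0"
  obtains g where "g holomorphic_on UNIV" "\<And>z. f z = (z - a) * g z"
proof
  show "(\<lambda>z. if z = a then deriv f a else (f z - f a) / (z - a)) holomorphic_on UNIV"
    by (rule pole_lemma[OF f]) simp
qed (use assms in auto)

lemma entire_factor_order_at_0:
  assumes f: "f holomorphic_on UNIV" and "f a \<noteq> 0"
  obtains g m where "g holomorphic_on UNIV" "\<And>z. f z = z ^ m * g z" "g 0 \<noteq> 0"
proof (cases "f constant_on UNIV \<or> f 0 \<noteq> 0")
  case True
  then have "f 0 \<noteq> 0" using assms by (metis constant_on_def UNIV_I)
  then show ?thesis using that[of f 0] f by simp
next
  case False
  then have f0: "f 0 = 0" and nc: "\<not> f constant_on UNIV" by auto
  obtain g r n where g: "0 < n" "0 < r" "g holomorphic_on ball 0 r"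
      "\<And>w. w \<in> ball 0 r \<Longrightarrow> f w = (w - 0)^n * g w" "\<And>w. w \<in> ball 0 r \<Longrightarrow> g w \<noteq> 0"
    by (rule holomorphic_factor_zero_nonconstant[OF f open_UNIV connected_UNIV UNIV_I f0 nc], rule that)
  let ?g = "\<lambda>z. if z = 0 then g 0 else f z / z ^ n"
  have "?g holomorphic_on ball 0 r \<union> (UNIV - {0})"
  proof (rule holomorphic_on_Un)
    show "?g holomorphic_on ball 0 r"
      by (rule holomorphic_transform[OF g(3)]) (use g in auto)
    have "(\<lambda>z. f z / z ^ n) holomorphic_on (UNIV - {0})"
      by (intro holomorphic_intros holomorphic_on_subset[OF f]) auto
    then show "?g holomorphic_on UNIV - {0}"
      by (rule holomorphic_transform) auto
  qed auto
  moreover have "ball 0 r \<union> (UNIV - {0}) = (UNIV :: complex set)" using g(2) by auto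
  moreover have "f z = z ^ n * ?g z" for z
    using g False by auto
  ultimately show ?thesis
    using that[of ?g n] g(2,5) by auto
qed

text \<open>Each factor \<open>z - l\<close> is traded for \<open>(r\<^sup>2 - cnj l * z) / r\<close>, of the same modulus on
  the circle, so the zeros disappear from \<open>Z\<close> without changing \<open>\<bar>f\<bar>\<close> there.\<close>

lemma entire_replace_zeros:
  assumes "finite Z" "f holomorphic_on UNIV" "\<And>l. l \<in> Z \<Longrightarrow> f l = 0" "0 \<notin> Z" "r > 0"
  shows "\<exists>h. h holomorphic_on UNIV \<and> (\<forall>z. cmod z = r \<longrightarrow> cmod (h z) = cmod (f z)) \<and>
    cmod (h 0) = cmod (f 0) * (\<Prod>l\<in>Z. r / cmod l)"
  using assms(1-4)
proof (induction Z arbitrary: f rule: finite_induct)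
  case empty
  then show ?case by auto
next
  case (insert l Z)
  from entire_factor_zero[of f l] insert.prems obtain g
    where g: "g holomorphic_on UNIV" "\<And>z. f z = (z - l) * g z" by auto
  define k where "k z = g z * ((of_real (r\<^sup>2) - cnj l * z) / of_real r)" for z
  have hk: "k holomorphic_on UNIV"
    unfolding k_def by (intro holomorphic_intros g) (use assms(5) in auto)
  have zk: "k m = 0" if "m \<in> Z" for m
  proof -
    have "m \<noteq> l" using that insert.hyps by auto
    then have "g m = 0" using g(2)[of m] insert.prems(2)[of m] that by auto
    then show ?thesis by (simp add: k_def)
  qed
  have ck: "cmod (k z) = cmod (f z)" if "cmod z = r" for z
  proof -
    have "of_real (r\<^sup>2) - cnj l * z = z * cnj (z - l)"
      using that complex_norm_square[of z] by (simp add: algebra_simps)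
    then have "cmod (of_real (r\<^sup>2) - cnj l * z) = r * cmod (z - l)"
      by (simp only: norm_mult complex_mod_cnj that)
    then show ?thesis
      using assms(5) by (simp add: k_def g(2) norm_mult norm_divide)
  qed
  from insert.IH[of k] hk zk insert.prems obtain h where
    h: "h holomorphic_on UNIV" "\<And>z. cmod z = r \<Longrightarrow> cmod (h z) = cmod (k z)"
       "cmod (h 0) = cmod (k 0) * (\<Prod>l\<in>Z. r / cmod l)" by auto
  have "l \<noteq> 0" using insert.prems by auto
  then have "cmod (k 0) = cmod (f 0) * (r / cmod l)"
    using assms(5) by (simp add: k_def g(2) norm_mult norm_divide power2_eq_square)
  then show ?case
    using h ck insert.hyps by (intro exI[of _ h]) (auto simp: ac_simps)
qed

lemma circle_mean_lower_bound:
  assumes f: "f holomorphic_on UNIV" and Z: "finite Z" "\<And>l. l \<in> Z \<Longrightarrow> f l = 0" "0 \<notin> Z" and "w \<noteq> 0"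
  shows "ennreal ((cmod (f 0) * (\<Prod>l\<in>Z. cmod w / cmod l))\<^sup>2)
    \<le> (\<integral>\<^sup>+t. ennreal ((cmod (f (w * cis (2 * pi * t))))\<^sup>2) \<partial>unit_interval)"
proof -
  from entire_replace_zeros[OF Z(1) f Z(2,3), of "cmod w"] \<open>w \<noteq> 0\<close> obtain h where
    h: "h holomorphic_on UNIV" "\<And>z. cmod z = cmod w \<Longrightarrow> cmod (h z) = cmod (f z)"
       "cmod (h 0) = cmod (f 0) * (\<Prod>l\<in>Z. cmod w / cmod l)" by auto
  have "cmod (h (w * cis (2 * pi * t))) = cmod (f (w * cis (2 * pi * t)))" for t
    by (rule h(2)) (simp add: norm_mult)
  then show ?thesis using circle_submean_entire[OF h(1), of w] by (simp add: h(3))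
qed

definition log_weight :: "nat \<Rightarrow> complex \<Rightarrow> real" where
  "log_weight n z = max 0 (ln (real n) - ln (max 1 ((cmod z)\<^sup>2)))"

definition log_statistic :: "nat \<Rightarrow> complex set \<Rightarrow> real" where
  "log_statistic n A = (\<Sum>l\<in>A \<inter> {z. (cmod z)\<^sup>2 < real n}. log_weight n l)"

lemma log_weight_nonneg [simp]: "0 \<le> log_weight n z"
  by (simp add: log_weight_def)

lemma log_weight_eq_0: "n \<ge> 1 \<Longrightarrow> real n \<le> (cmod z)\<^sup>2 \<Longrightarrow> log_weight n z = 0"
  using ln_mono[of "real n" "(cmod z)\<^sup>2"] unfolding log_weight_def by (intro max_absorb1) simp

lemma exp_log_weight_le:
  assumes "z \<noteq> 0" "(cmod z)\<^sup>2 < real n"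
  shows "exp (log_weight n z) \<le> real n / (cmod z)\<^sup>2"
proof (cases "ln (real n) \<ge> ln (max 1 ((cmod z)\<^sup>2))")
  case True
  have n: "real n > 0" using assms by (meson le_less_trans zero_le_power2)
  have "exp (log_weight n z) = real n / max 1 ((cmod z)\<^sup>2)"
    using True n by (simp add: log_weight_def exp_diff)
  also have "\<dots> \<le> real n / (cmod z)\<^sup>2"
    using assms by (intro divide_left_mono) auto
  finally show ?thesis .
next
  case False
  then show ?thesis using assms by (simp add: log_weight_def)
qed

lemma exp_log_statistic_le:
  assumes "finite (A \<inter> {z. (cmod z)\<^sup>2 < real n})" "0 \<notin> A" "real n \<le> R\<^sup>2" "0 \<le> R"
  shows "exp (log_statistic n A) \<le> (\<Prod>l\<in>A \<inter> {z. (cmod z)\<^sup>2 < real n}. R / cmod l)\<^sup>2"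
proof -
  have "exp (log_statistic n A) = (\<Prod>l\<in>A \<inter> {z. (cmod z)\<^sup>2 < real n}. exp (log_weight n l))"
    using assms by (simp add: log_statistic_def exp_sum)
  also have "\<dots> \<le> (\<Prod>l\<in>A \<inter> {z. (cmod z)\<^sup>2 < real n}. (R / cmod l)\<^sup>2)"
  proof (intro prod_mono conjI)
    fix l assume l: "l \<in> A \<inter> {z. (cmod z)\<^sup>2 < real n}"
    then have "exp (log_weight n l) \<le> real n / (cmod l)\<^sup>2"
      using assms by (intro exp_log_weight_le) auto
    also have "\<dots> \<le> (R / cmod l)\<^sup>2"
      using assms by (simp add: power_divide divide_right_mono)
    finally show "exp (log_weight n l) \<le> (R / cmod l)\<^sup>2" .
  qed auto
  also have "\<dots> = (\<Prod>l\<in>A \<inter> {z. (cmod z)\<^sup>2 < real n}. R / cmod l)\<^sup>2"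
    by (simp add: prod_power_distrib)
  finally show ?thesis .
qed

lemma log_statistic_sum_bounded:
  assumes f: "f holomorphic_on UNIV" "f a \<noteq> 0"
    and L2: "(\<integral>\<^sup>+z. ennreal ((cmod (f z))\<^sup>2) \<partial>complex_gaussian) < \<infinity>"
    and A: "\<And>l. l \<in> A \<Longrightarrow> f l = 0" "0 \<notin> A" "\<And>n. finite (A \<inter> {z. (cmod z)\<^sup>2 < real n})"
  shows "\<exists>C. \<forall>N. (\<Sum>n = 1..N. exp (log_statistic n A - real n)) \<le> C"
proof -
  from entire_factor_order_at_0[OF f] obtain g m where
    g: "g holomorphic_on UNIV" "\<And>z. f z = z ^ m * g z" "g 0 \<noteq> 0" by metis
  note [measurable] = borel_measurable_entire[OF f(1)]
  obtain E where E: "(\<integral>\<^sup>+z. ennreal ((cmod (f z))\<^sup>2) \<partial>complex_gaussian) = ennreal E" "E \<ge> 0"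
    using L2 by (metis ennreal_cases less_irrefl infinity_ennreal_def)
  define c where "c = (cmod (g 0))\<^sup>2 / exp 1"
  have c: "c > 0" using g by (simp add: c_def)
  define D where "D n = {z. real n \<le> (cmod z)\<^sup>2 \<and> (cmod z)\<^sup>2 < real n + 1}" for n
  have [measurable]: "D n \<in> sets borel" for n unfolding D_def by measurable
  have disj: "disjoint_family D"
  proof (unfold disjoint_family_on_def, intro ballI impI equals0I)
    fix i j z assume "i \<noteq> j" "z \<in> D i \<inter> D j"
    then have "real i < real (Suc j)" "real j < real (Suc i)" by (auto simp: D_def)
    then show False using \<open>i \<noteq> j\<close> unfolding of_nat_less_iff by linarith
  qed
  have annulus: "ennreal (c * exp (log_statistic n A - real n))
      \<le> (\<integral>\<^sup>+z. ennreal ((cmod (f z))\<^sup>2) * indicator (D n) z \<partial>complex_gaussian)" if n: "n \<ge> 1" for n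
  proof -
    let ?K = "ennreal ((cmod (g 0))\<^sup>2 * exp (log_statistic n A))"
    let ?Z = "A \<inter> {z. (cmod z)\<^sup>2 < real n}"
    have "ennreal (exp (- (real n + 1))) = (\<integral>\<^sup>+z. ennreal (exp (- (real n + 1))) * indicator (D n) z \<partial>plane_measure)"
      using emeasure_plane_annulus[of "real n" "real n + 1"]
      by (subst nn_integral_cmult_indicator) (auto simp: D_def)
    also have "\<dots> \<le> (\<integral>\<^sup>+z. ennreal (exp (- (cmod z)\<^sup>2)) * indicator (D n) z \<partial>plane_measure)"
      by (intro nn_integral_mono) (auto simp: D_def split: split_indicator)
    also have "\<dots> = emeasure complex_gaussian (D n)"
      by (subst nn_integral_complex_gaussian[symmetric]) auto
    finally have gD: "ennreal (exp (- (real n + 1))) \<le> emeasure complex_gaussian (D n)" .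
    have circ: "?K * indicator (D n) z
      \<le> (\<integral>\<^sup>+t. ennreal ((cmod (f (z * cis (2 * pi * t))))\<^sup>2) * indicator (D n) (z * cis (2 * pi * t)) \<partial>unit_interval)" for z
    proof (cases "z \<in> D n")
      case True
      then have z: "real n \<le> (cmod z)\<^sup>2" by (simp add: D_def)
      with n have z1: "1 \<le> cmod z" by (intro power2_le_imp_le[of 1 "cmod z"]) auto
      have gz: "g l = 0" if "l \<in> ?Z" for l
        using A(1)[of l] A(2) g(2)[of l] that by (cases "l = 0") auto
      have "?K \<le> ennreal ((cmod (g 0) * (\<Prod>l\<in>?Z. cmod z / cmod l))\<^sup>2)"
        using exp_log_statistic_le[OF A(3) A(2) z] by (auto simp: power_mult_distrib intro!: ennreal_leI mult_left_mono)
      also have "\<dots> \<le> (\<integral>\<^sup>+t. ennreal ((cmod (g (z * cis (2 * pi * t))))\<^sup>2) \<partial>unit_interval)"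
        by (rule circle_mean_lower_bound[OF g(1) A(3)]) (use A(2) z1 gz in auto)
      also have "\<dots> \<le> (\<integral>\<^sup>+t. ennreal ((cmod (f (z * cis (2 * pi * t))))\<^sup>2) \<partial>unit_interval)"
      proof (intro nn_integral_mono ennreal_leI power_mono)
        fix t
        have "1 * cmod (g (z * cis (2 * pi * t))) \<le> cmod z ^ m * cmod (g (z * cis (2 * pi * t)))"
          using z1 by (intro mult_right_mono) auto
        then show "cmod (g (z * cis (2 * pi * t))) \<le> cmod (f (z * cis (2 * pi * t)))"
          by (simp add: g(2) norm_mult norm_power)
      qed auto
      also have "\<dots> = (\<integral>\<^sup>+t. ennreal ((cmod (f (z * cis (2 * pi * t))))\<^sup>2) * indicator (D n) (z * cis (2 * pi * t)) \<partial>unit_interval)"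
        using True by (intro nn_integral_cong) (auto simp: D_def norm_mult)
      finally show ?thesis using True by simp
    qed simp
    have "ennreal (c * exp (log_statistic n A - real n)) = ?K * ennreal (exp (- (real n + 1)))"
      unfolding c_def by (subst ennreal_mult[symmetric]) (auto simp: exp_diff exp_minus exp_add field_simps)
    also have "\<dots> \<le> ?K * emeasure complex_gaussian (D n)"
      by (intro mult_left_mono gD) auto
    also have "\<dots> = (\<integral>\<^sup>+z. ?K * indicator (D n) z \<partial>complex_gaussian)"
      by (subst nn_integral_cmult_indicator) auto
    also have "\<dots> \<le> (\<integral>\<^sup>+z. (\<integral>\<^sup>+t. ennreal ((cmod (f (z * cis (2 * pi * t))))\<^sup>2) * indicator (D n) (z * cis (2 * pi * t)) \<partial>unit_interval) \<partial>complex_gaussian)"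
      by (intro nn_integral_mono circ)
    also have "\<dots> = (\<integral>\<^sup>+z. ennreal ((cmod (f z))\<^sup>2) * indicator (D n) z \<partial>complex_gaussian)"
      by (rule gaussian_circle_average[symmetric]) measurable
    finally show ?thesis .
  qed
  have "(\<Sum>n = 1..N. exp (log_statistic n A - real n)) \<le> E / c" for N
  proof -
    have "ennreal (\<Sum>n = 1..N. c * exp (log_statistic n A - real n)) = (\<Sum>n = 1..N. ennreal (c * exp (log_statistic n A - real n)))"
      using c by (intro sum_ennreal[symmetric]) auto
    also have "\<dots> \<le> (\<Sum>n = 1..N. \<integral>\<^sup>+z. ennreal ((cmod (f z))\<^sup>2) * indicator (D n) z \<partial>complex_gaussian)"
      by (intro sum_mono annulus) auto
    also have "\<dots> = (\<integral>\<^sup>+z. (\<Sum>n = 1..N. ennreal ((cmod (f z))\<^sup>2) * indicator (D n) z) \<partial>complex_gaussian)"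
      by (rule nn_integral_sum[symmetric]) measurable
    also have "\<dots> = (\<integral>\<^sup>+z. ennreal ((cmod (f z))\<^sup>2) * indicator (\<Union>n\<in>{1..N}. D n) z \<partial>complex_gaussian)"
    proof (rule nn_integral_cong)
      fix z
      have "indicator (\<Union>n\<in>{1..N}. D n) z = (\<Sum>n = 1..N. indicator (D n) z :: ennreal)"
        by (rule indicator_UN_disjoint) (auto intro: disjoint_family_on_mono[OF _ disj])
      then show "(\<Sum>n = 1..N. ennreal ((cmod (f z))\<^sup>2) * indicator (D n) z)
          = ennreal ((cmod (f z))\<^sup>2) * indicator (\<Union>n\<in>{1..N}. D n) z"
        by (simp add: sum_distrib_left)
    qed
    also have "\<dots> \<le> ennreal E"
      unfolding E(1)[symmetric] by (intro nn_integral_mono) (auto split: split_indicator)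
    finally have "c * (\<Sum>n = 1..N. exp (log_statistic n A - real n)) \<le> E"
      using E(2) c by (simp add: sum_distrib_left sum_nonneg)
    then show ?thesis using c by (simp add: field_simps)
  qed
  then show ?thesis by blast
qed

section \<open>Linear statistics of the Ginibre ensemble\<close>

lemma emeasure_count_space_image:
  assumes "inj_on f X"
  shows "emeasure (count_space UNIV) (f ` X) = emeasure (count_space UNIV) X"
  using assms by (auto simp: emeasure_count_space card_image finite_image_iff)

lemma det_mat_1: "Determinant.det (Matrix.mat 1 1 f) = f (0, 0)"
  by (subst det_single[of _]) auto

lemma det_mat_2:
  fixes f :: "nat \<times> nat \<Rightarrow> 'a :: comm_ring_1"
  shows "Determinant.det (Matrix.mat 2 2 f) = f (0, 0) * f (1, 1) - f (0, 1) * f (1, 0)"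
proof -
  let ?A = "Matrix.mat 2 2 f"
  have c: "mat_delete ?A i 0 \<in> carrier_mat 1 1" for i
    by (rule carrier_matI) (simp_all add: mat_delete_def)
  have 1: "Determinant.det ?A = (\<Sum>i<2. ?A $$ (i, 0) * cofactor ?A i 0)"
    by (rule laplace_expansion_column[of _ 2]) auto
  have 2: "{..<2::nat} = {0, 1}" by auto
  have 3: "cofactor ?A 0 0 = f (1, 1)"
    unfolding cofactor_def det_single[OF c] by (simp add: mat_delete_def)
  have 4: "cofactor ?A 1 0 = - f (0, 1)"
    unfolding cofactor_def det_single[OF c] by (simp add: mat_delete_def)
  have 5: "?A $$ (0,0) = f (0,0)" "?A $$ (1,0) = f (1,0)" by auto
  show ?thesis unfolding 1 2 using 3 4 5 by simp
qed

lemma nn_integral_PiM_lessThan_1: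
  assumes "sigma_finite_measure N" and [measurable]: "F \<in> borel_measurable N"
  shows "(\<integral>\<^sup>+x. F (x 0) \<partial>Pi\<^sub>M {..<1::nat} (\<lambda>_. N)) = (\<integral>\<^sup>+u. F u \<partial>N)"
proof -
  interpret sigma_finite_measure N by fact
  interpret product_sigma_finite "\<lambda>_::nat. N" ..
  have "{..<1::nat} = {0}" by auto
  then show ?thesis by (simp add: product_nn_integral_singleton)
qed

lemma nn_integral_PiM_lessThan_2:
  assumes "sigma_finite_measure N" and [measurable]: "(\<lambda>(u, v). F u v) \<in> borel_measurable (N \<Otimes>\<^sub>M N)"
  shows "(\<integral>\<^sup>+x. F (x 0) (x 1) \<partial>Pi\<^sub>M {..<2::nat} (\<lambda>_. N)) = (\<integral>\<^sup>+u. \<integral>\<^sup>+v. F u v \<partial>N \<partial>N)"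
proof -
  interpret sigma_finite_measure N by fact
  interpret product_sigma_finite "\<lambda>_::nat. N" ..
  have I: "{..<2::nat} = insert 1 {0}" by auto
  have "(\<integral>\<^sup>+x. F (x 0) (x 1) \<partial>Pi\<^sub>M (insert 1 {0::nat}) (\<lambda>_. N))
    = (\<integral>\<^sup>+x. \<integral>\<^sup>+v. F (x 0) v \<partial>N \<partial>Pi\<^sub>M {0::nat} (\<lambda>_. N))"
    by (subst product_nn_integral_insert) auto
  also have "\<dots> = (\<integral>\<^sup>+u. \<integral>\<^sup>+v. F u v \<partial>N \<partial>N)"
    by (rule product_nn_integral_singleton[where f = "\<lambda>u. \<integral>\<^sup>+v. F u v \<partial>N"]) measurable
  finally show ?thesis by (simp only: I)
qed

lemma exp_norm_square: "exp (z * cnj z) = complex_of_real (exp ((cmod z)\<^sup>2))"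
  unfolding complex_norm_square[symmetric] by (rule exp_of_real)

lemma n_point_intensityD:
  assumes "n_point_intensity M \<Lambda> \<mu> n \<rho>" "B \<in> sets (Pi\<^sub>M {..<n} (\<lambda>_. \<mu>))"
  shows "(\<integral>\<^sup>+\<omega>. emeasure (count_space UNIV) {x \<in> B. (\<forall>i<n. x i \<in> \<Lambda> \<omega>) \<and> inj_on x {..<n}} \<partial>M)
    = (\<integral>\<^sup>+x. ennreal (\<rho> x) * indicator B x \<partial>(Pi\<^sub>M {..<n} (\<lambda>_. \<mu>)))"
  using assms unfolding n_point_intensity_def by blast

definition repulsion :: "complex \<Rightarrow> complex \<Rightarrow> real" where
  "repulsion u v = exp (- (cmod (u - v))\<^sup>2)"

lemma repulsion_le_1: "repulsion u v \<le> 1" and repulsion_pos: "0 < repulsion u v"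
  by (auto simp: repulsion_def)

lemma repulsion_commute: "repulsion u v = repulsion v u"
  by (simp add: repulsion_def norm_minus_commute)

lemma borel_measurable_repulsion [measurable (raw)]:
  assumes [measurable]: "f \<in> borel_measurable N" "g \<in> borel_measurable N"
  shows "(\<lambda>x. repulsion (f x) (g x)) \<in> borel_measurable N"
  unfolding repulsion_def by measurable

locale ginibre =
  fixes M :: "'w measure" and \<Lambda> :: "'w \<Rightarrow> complex set"
  assumes ginibre: "ginibre_ensemble M \<Lambda>"
begin

sublocale point_process M \<Lambda>
  using ginibre by (simp add: ginibre_ensemble_def determinantal_process_def)

lemma intensity:
  assumes "n \<ge> 1"
  obtains \<rho> where "n_point_intensity M \<Lambda> complex_gaussian n \<rho>"
    "AE x in Pi\<^sub>M {..<n} (\<lambda>_. complex_gaussian). complex_of_real (\<rho> x)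
      = Determinant.det (Matrix.mat n n (\<lambda>(i, j). exp (x i * cnj (x j))))"
  using ginibre assms by (auto simp: ginibre_ensemble_def determinantal_process_def)

lemma first_intensity:
  assumes A [measurable]: "A \<in> sets borel"
  shows "(\<integral>\<^sup>+\<omega>. emeasure (count_space UNIV) (\<Lambda> \<omega> \<inter> A) \<partial>M) = emeasure plane_measure A"
proof -
  let ?P = "Pi\<^sub>M {..<1::nat} (\<lambda>_. complex_gaussian)"
  obtain \<rho> where \<rho>: "n_point_intensity M \<Lambda> complex_gaussian 1 \<rho>"
    "AE x in ?P. complex_of_real (\<rho> x) = Determinant.det (Matrix.mat 1 1 (\<lambda>(i, j). exp (x i * cnj (x j))))"
    by (rule intensity[of 1]) auto
  let ?B = "{x \<in> space ?P. x 0 \<in> A}"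
  have B [measurable]: "?B \<in> sets ?P" by measurable
  have img: "{x \<in> ?B. (\<forall>i<1. x i \<in> \<Lambda> \<omega>) \<and> inj_on x {..<1}} = (\<lambda>u. \<lambda>i\<in>{..<1::nat}. u) ` (\<Lambda> \<omega> \<inter> A)" (is "?L = ?f ` _") for \<omega>
  proof (intro equalityI subsetI)
    fix x assume x: "x \<in> ?L"
    then have "x = ?f (x 0)"
      by (auto simp: space_PiM PiE_def extensional_def fun_eq_iff)
    moreover have "x 0 \<in> \<Lambda> \<omega> \<inter> A" using x by auto
    ultimately show "x \<in> ?f ` (\<Lambda> \<omega> \<inter> A)" by blast
  qed (auto simp: space_PiM inj_on_def split: if_splits)
  have "emeasure (count_space UNIV) {x \<in> ?B. (\<forall>i<1. x i \<in> \<Lambda> \<omega>) \<and> inj_on x {..<1}}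
    = emeasure (count_space UNIV) (\<Lambda> \<omega> \<inter> A)" for \<omega>
    unfolding img by (rule emeasure_count_space_image) (auto dest!: fun_cong[of _ _ 0] intro!: inj_onI)
  then have "(\<integral>\<^sup>+\<omega>. emeasure (count_space UNIV) (\<Lambda> \<omega> \<inter> A) \<partial>M) = (\<integral>\<^sup>+x. ennreal (\<rho> x) * indicator ?B x \<partial>?P)"
    using n_point_intensityD[OF \<rho>(1) B] by (simp only:)
  also have "\<dots> = (\<integral>\<^sup>+x. (\<lambda>u. ennreal (exp ((cmod u)\<^sup>2)) * indicator A u) (x 0) \<partial>?P)"
  proof (rule nn_integral_cong_AE)
    show "AE x in ?P. ennreal (\<rho> x) * indicator ?B x = (\<lambda>u. ennreal (exp ((cmod u)\<^sup>2)) * indicator A u) (x 0)"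
      using \<rho>(2) AE_space
    proof eventually_elim
      case (elim x)
      have "complex_of_real (\<rho> x) = complex_of_real (exp ((cmod (x 0))\<^sup>2))"
        unfolding elim det_mat_1 by (simp add: exp_norm_square)
      then have "\<rho> x = exp ((cmod (x 0))\<^sup>2)" by (simp only: of_real_eq_iff)
      then show ?case using elim by (simp split: split_indicator)
    qed
  qed
  also have "\<dots> = (\<integral>\<^sup>+u. ennreal (exp ((cmod u)\<^sup>2)) * indicator A u \<partial>complex_gaussian)"
    by (rule nn_integral_PiM_lessThan_1) (auto intro: gaussian.sigma_finite_measure_axioms)
  also have "\<dots> = (\<integral>\<^sup>+u. indicator A u \<partial>plane_measure)"
    by (subst nn_integral_complex_gaussian)
       (auto simp: mult.assoc[symmetric] ennreal_mult[symmetric] exp_add[symmetric])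
  finally show ?thesis by simp
qed

lemma second_intensity:
  assumes A [measurable]: "A \<in> sets borel" and A' [measurable]: "A' \<in> sets borel"
  shows "(\<integral>\<^sup>+\<omega>. emeasure (count_space UNIV) ((\<Lambda> \<omega> \<inter> A) \<times> (\<Lambda> \<omega> \<inter> A') - Id) \<partial>M)
    = (\<integral>\<^sup>+u. \<integral>\<^sup>+v. indicator A u * indicator A' v * ennreal (1 - repulsion u v) \<partial>plane_measure \<partial>plane_measure)"
proof -
  let ?P = "Pi\<^sub>M {..<2::nat} (\<lambda>_. complex_gaussian)"
  obtain \<rho> where \<rho>: "n_point_intensity M \<Lambda> complex_gaussian 2 \<rho>"
    "AE x in ?P. complex_of_real (\<rho> x) = Determinant.det (Matrix.mat 2 2 (\<lambda>(i, j). exp (x i * cnj (x j))))"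
    by (rule intensity[of 2]) auto
  let ?B = "{x \<in> space ?P. x 0 \<in> A \<and> x 1 \<in> A'}"
  have B [measurable]: "?B \<in> sets ?P" by measurable
  have less2: "i < 2 \<longleftrightarrow> i = 0 \<or> i = 1" for i :: nat by auto
  have img: "{x \<in> ?B. (\<forall>i<2. x i \<in> \<Lambda> \<omega>) \<and> inj_on x {..<2}}
    = (\<lambda>(u, v). \<lambda>i\<in>{..<2::nat}. if i = 0 then u else v) ` ((\<Lambda> \<omega> \<inter> A) \<times> (\<Lambda> \<omega> \<inter> A') - Id)" (is "?L = ?f ` ?R") for \<omega>
  proof (intro equalityI subsetI)
    fix x assume x: "x \<in> ?L"
    then have "x = ?f (x 0, x 1)"
      by (auto simp: space_PiM PiE_def extensional_def fun_eq_iff less2)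
    moreover have "x 0 \<noteq> x 1"
      using x inj_onD[of x "{..<2}" 0 1] by auto
    then have "(x 0, x 1) \<in> ?R"
      using x by simp
    ultimately show "x \<in> ?f ` ?R" by blast
  next
    fix x assume "x \<in> ?f ` ?R"
    then obtain u v where x: "x = ?f (u, v)" "(u, v) \<in> ?R" by blast
    have "inj_on x {..<2}"
      using x by (intro inj_onI) (auto simp: less2 split: if_splits)
    then show "x \<in> ?L"
      using x by (simp add: space_PiM less2)
  qed
  have "emeasure (count_space UNIV) {x \<in> ?B. (\<forall>i<2. x i \<in> \<Lambda> \<omega>) \<and> inj_on x {..<2}}
    = emeasure (count_space UNIV) ((\<Lambda> \<omega> \<inter> A) \<times> (\<Lambda> \<omega> \<inter> A') - Id)" for \<omega>
    unfolding img
  proof (rule emeasure_count_space_image, rule inj_onI)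
    fix p q :: "complex \<times> complex"
    assume "?f p = ?f q"
    from fun_cong[OF this, of 0] fun_cong[OF this, of 1] show "p = q"
      by (auto simp: case_prod_beta prod_eq_iff)
  qed
  then have "(\<integral>\<^sup>+\<omega>. emeasure (count_space UNIV) ((\<Lambda> \<omega> \<inter> A) \<times> (\<Lambda> \<omega> \<inter> A') - Id) \<partial>M)
      = (\<integral>\<^sup>+x. ennreal (\<rho> x) * indicator ?B x \<partial>?P)"
    using n_point_intensityD[OF \<rho>(1) B] by (simp only:)
  also have "\<dots> = (\<integral>\<^sup>+x. (\<lambda>u v. ennreal (exp ((cmod u)\<^sup>2)) * (ennreal (exp ((cmod v)\<^sup>2)) * (indicator A u * indicator A' v * ennreal (1 - repulsion u v)))) (x 0) (x 1) \<partial>?P)"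
  proof (rule nn_integral_cong_AE)
    show "AE x in ?P. ennreal (\<rho> x) * indicator ?B x = (\<lambda>u v. ennreal (exp ((cmod u)\<^sup>2)) * (ennreal (exp ((cmod v)\<^sup>2)) * (indicator A u * indicator A' v * ennreal (1 - repulsion u v)))) (x 0) (x 1)"
      using \<rho>(2) AE_space
    proof eventually_elim
      case (elim x)
      have e1: "exp (x 0 * cnj (x 0)) * exp (x 1 * cnj (x 1)) = complex_of_real (exp ((cmod (x 0))\<^sup>2) * exp ((cmod (x 1))\<^sup>2))"
        by (simp add: exp_norm_square)
      have "x 0 * cnj (x 1) + x 1 * cnj (x 0) = complex_of_real ((cmod (x 0))\<^sup>2 + (cmod (x 1))\<^sup>2 - (cmod (x 0 - x 1))\<^sup>2)"
        by (simp only: of_real_add of_real_diff complex_norm_square) (simp add: algebra_simps)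
      then have "exp (x 0 * cnj (x 1)) * exp (x 1 * cnj (x 0)) = complex_of_real (exp ((cmod (x 0))\<^sup>2 + (cmod (x 1))\<^sup>2 - (cmod (x 0 - x 1))\<^sup>2))"
        by (simp only: exp_add[symmetric] exp_of_real)
      also have "exp ((cmod (x 0))\<^sup>2 + (cmod (x 1))\<^sup>2 - (cmod (x 0 - x 1))\<^sup>2) = exp ((cmod (x 0))\<^sup>2) * exp ((cmod (x 1))\<^sup>2) * repulsion (x 0) (x 1)"
        by (simp add: repulsion_def exp_add[symmetric])
      finally have "complex_of_real (\<rho> x) = complex_of_real (exp ((cmod (x 0))\<^sup>2) * exp ((cmod (x 1))\<^sup>2) * (1 - repulsion (x 0) (x 1)))"
        unfolding elim det_mat_2 using e1 by (simp add: algebra_simps)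
      then have "\<rho> x = exp ((cmod (x 0))\<^sup>2) * exp ((cmod (x 1))\<^sup>2) * (1 - repulsion (x 0) (x 1))"
        by (simp only: of_real_eq_iff)
      then show ?case
        using elim repulsion_le_1 by (simp add: ennreal_mult mult.assoc split: split_indicator)
    qed
  qed
  also have "\<dots> = (\<integral>\<^sup>+u. \<integral>\<^sup>+v. ennreal (exp ((cmod u)\<^sup>2)) * (ennreal (exp ((cmod v)\<^sup>2)) * (indicator A u * indicator A' v * ennreal (1 - repulsion u v))) \<partial>complex_gaussian \<partial>complex_gaussian)"
    by (rule nn_integral_PiM_lessThan_2) (auto intro: gaussian.sigma_finite_measure_axioms)
  also have "\<dots> = (\<integral>\<^sup>+u. ennreal (exp ((cmod u)\<^sup>2)) * (\<integral>\<^sup>+v. indicator A u * indicator A' v * ennreal (1 - repulsion u v) \<partial>plane_measure) \<partial>complex_gaussian)"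
    by (intro nn_integral_cong, subst nn_integral_cmult, measurable, subst nn_integral_complex_gaussian)
       (auto simp: mult.assoc[symmetric] ennreal_mult[symmetric] exp_add[symmetric])
  also have "\<dots> = (\<integral>\<^sup>+u. \<integral>\<^sup>+v. indicator A u * indicator A' v * ennreal (1 - repulsion u v) \<partial>plane_measure \<partial>plane_measure)"
    by (subst nn_integral_complex_gaussian, measurable)
       (auto simp: mult.assoc[symmetric] ennreal_mult[symmetric] exp_add[symmetric])
  finally show ?thesis .
qed

end

definition log_gradient :: "nat \<Rightarrow> complex \<Rightarrow> real" where
  "log_gradient n z = (if (cmod z)\<^sup>2 < real n then 1 / max 1 ((cmod z)\<^sup>2) else 0)"

lemma log_gradient_nonneg [simp]: "0 \<le> log_gradient n z"
  by (simp add: log_gradient_def le_max_iff_disj)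

lemma borel_measurable_log_weight [measurable]: "log_weight n \<in> borel_measurable borel"
  unfolding log_weight_def[abs_def] by measurable

lemma borel_measurable_log_gradient [measurable]: "log_gradient n \<in> borel_measurable borel"
  unfolding log_gradient_def[abs_def] by measurable

lemma log_weight_diff_square_le:
  assumes n: "n \<ge> 1"
  shows "(log_weight n u - log_weight n v)\<^sup>2 \<le> 4 * (cmod (u - v))\<^sup>2 * (log_gradient n u + log_gradient n v)"
proof -
  have *: "(log_weight n u - log_weight n v)\<^sup>2 \<le> 4 * (cmod (u - v))\<^sup>2 * log_gradient n u" if uv: "cmod u \<le> cmod v" for u v
  proof (cases "(cmod u)\<^sup>2 < real n")
    case False
    then have "real n \<le> (cmod u)\<^sup>2" by simp
    moreover have "(cmod u)\<^sup>2 \<le> (cmod v)\<^sup>2" using uv by (intro power_mono) auto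
    then have "real n \<le> (cmod v)\<^sup>2" using \<open>real n \<le> (cmod u)\<^sup>2\<close> by linarith
    ultimately have "log_weight n u = 0" "log_weight n v = 0"
      by (auto intro!: log_weight_eq_0[OF n])
    then show ?thesis by simp
  next
    case True
    define a where "a = max 1 (cmod u)"
    define b where "b = max 1 (cmod v)"
    have ab: "1 \<le> a" "a \<le> b" using uv by (auto simp: a_def b_def)
    have sq: "max 1 (x\<^sup>2) = (max 1 x)\<^sup>2" if "x \<ge> 0" for x :: real
      using that one_le_power[of x 2] power_le_one[of x 2] by (cases "x \<le> 1") (auto simp: max_def)
    have ln2: "ln (max 1 ((cmod z)\<^sup>2)) = 2 * ln (max 1 (cmod z))" for z :: complex
      by (simp add: sq ln_realpow)
    have "\<bar>log_weight n u - log_weight n v\<bar> \<le> \<bar>ln (max 1 ((cmod v)\<^sup>2)) - ln (max 1 ((cmod u)\<^sup>2))\<bar>"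
      unfolding log_weight_def by linarith
    also have "\<dots> = 2 * ln (b / a)"
      using ab by (simp add: ln2 a_def[symmetric] b_def[symmetric] ln_div)
    also have "\<dots> \<le> 2 * (b / a - 1)"
      using ab ln_le_minus_one[of "b / a"] by simp
    also have "\<dots> = 2 * ((b - a) / a)" using ab by (simp add: field_simps)
    also have "\<dots> \<le> 2 * (cmod (u - v) / a)"
    proof -
      have "b - a \<le> cmod v - cmod u" using uv by (auto simp: a_def b_def)
      also have "\<dots> \<le> cmod (u - v)" by (metis norm_minus_commute norm_triangle_ineq2)
      finally show ?thesis using ab by (simp add: divide_right_mono)
    qed
    finally have "\<bar>log_weight n u - log_weight n v\<bar>\<^sup>2 \<le> (2 * (cmod (u - v) / a))\<^sup>2"
      by (intro power_mono) auto
    also have "\<dots> = 4 * (cmod (u - v))\<^sup>2 * log_gradient n u"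
      using True by (simp add: log_gradient_def sq a_def power_mult_distrib power_divide)
    finally show ?thesis by simp
  qed
  show ?thesis
  proof (cases "cmod u \<le> cmod v")
    case True
    from *[OF True] show ?thesis
      by (rule order_trans) (intro mult_left_mono, auto)
  next
    case False
    then have "(log_weight n v - log_weight n u)\<^sup>2 \<le> 4 * (cmod (v - u))\<^sup>2 * log_gradient n v" by (intro *) auto
    also have "\<dots> \<le> 4 * (cmod (v - u))\<^sup>2 * (log_gradient n u + log_gradient n v)" by (intro mult_left_mono) auto
    finally show ?thesis by (simp add: norm_minus_commute power2_commute)
  qed
qed

lemma nn_integral_log_weight:
  assumes n: "n \<ge> 1"
  shows "(\<integral>\<^sup>+z. ennreal (log_weight n z) \<partial>plane_measure) = ennreal (real n - 1)"
proof -
  let ?f = "\<lambda>t::real. ennreal (1 / t) * indicator {1..real n} t"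
  have w: "ennreal (log_weight n z) = (\<integral>\<^sup>+t. ?f t * indicator {(cmod z)\<^sup>2<..} t \<partial>lborel)" for z
  proof (cases "max 1 ((cmod z)\<^sup>2) \<le> real n")
    case True
    let ?m = "max 1 ((cmod z)\<^sup>2)"
    have "(\<integral>\<^sup>+t. ?f t * indicator {(cmod z)\<^sup>2<..} t \<partial>lborel) = (\<integral>\<^sup>+t. ennreal (1 / t) * indicator {?m..real n} t \<partial>lborel)"
      using AE_lborel_singleton[of "(cmod z)\<^sup>2"] by (intro nn_integral_cong_AE) (auto split: split_indicator)
    also have "\<dots> = ennreal (ln (real n) - ln ?m)"
      using True by (intro nn_integral_FTC_Icc) (auto intro!: derivative_eq_intros)
    also have "ln (real n) - ln ?m = log_weight n z"
      unfolding log_weight_def using True by (simp add: ln_mono)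
    finally show ?thesis ..
  next
    case False
    then have "real n < (cmod z)\<^sup>2" using n by auto
    then have "(\<lambda>t. ?f t * indicator {(cmod z)\<^sup>2<..} t) = (\<lambda>t. 0)" by (auto split: split_indicator)
    moreover have "log_weight n z = 0" using \<open>real n < (cmod z)\<^sup>2\<close> n by (intro log_weight_eq_0) auto
    ultimately show ?thesis by simp
  qed
  have "(\<integral>\<^sup>+z. ennreal (log_weight n z) \<partial>plane_measure) = (\<integral>\<^sup>+t. ?f t * ennreal t \<partial>lborel)"
    unfolding w by (rule nn_integral_plane_layer_cake) measurable
  also have "\<dots> = (\<integral>\<^sup>+t. indicator {1..real n} t \<partial>lborel)"
    by (intro nn_integral_cong) (auto split: split_indicator simp: ennreal_mult[symmetric])
  finally show ?thesis using n by simp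
qed

lemma sum_inverse_le: "n \<ge> 1 \<Longrightarrow> (\<Sum>k = 1..n. 1 / real k) \<le> 1 + ln (real n)"
proof (induction n rule: dec_induct)
  case (step n)
  have "ln (real n / real (Suc n)) \<le> real n / real (Suc n) - 1"
    using step by (intro ln_le_minus_one) auto
  then have "1 / real (Suc n) \<le> ln (real (Suc n)) - ln (real n)"
    using step by (simp add: ln_div field_simps)
  then show ?case using step by simp
qed simp

lemma nn_integral_log_gradient:
  assumes n: "n \<ge> 1"
  shows "(\<integral>\<^sup>+z. ennreal (log_gradient n z) \<partial>plane_measure) \<le> ennreal (2 + ln (real n))"
proof -
  define D where "D k = {z. real k \<le> (cmod z)\<^sup>2 \<and> (cmod z)\<^sup>2 < real k + 1}" for k
  have [measurable]: "D k \<in> sets borel" for k unfolding D_def by measurable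
  have D: "emeasure plane_measure (D k) = 1" for k
    unfolding D_def by (subst emeasure_plane_annulus) auto
  have pt: "ennreal (log_gradient n z) \<le> (\<Sum>k<n. ennreal (1 / max 1 (real k)) * indicator (D k) z)" for z
  proof (cases "(cmod z)\<^sup>2 < real n")
    case True
    define k where "k = nat \<lfloor>(cmod z)\<^sup>2\<rfloor>"
    have k: "real k \<le> (cmod z)\<^sup>2" "(cmod z)\<^sup>2 < real k + 1" unfolding k_def by auto
    then have "z \<in> D k" "k < n" using True by (auto simp: D_def)
    have "ennreal (log_gradient n z) \<le> ennreal (1 / max 1 (real k)) * indicator (D k) z"
      using True k \<open>z \<in> D k\<close> by (auto simp: log_gradient_def intro!: ennreal_leI divide_left_mono)
    also have "\<dots> \<le> (\<Sum>k<n. ennreal (1 / max 1 (real k)) * indicator (D k) z)"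
      using \<open>k < n\<close> by (intro member_le_sum) auto
    finally show ?thesis .
  qed (simp add: log_gradient_def)
  have "(\<integral>\<^sup>+z. ennreal (log_gradient n z) \<partial>plane_measure)
      \<le> (\<integral>\<^sup>+z. (\<Sum>k<n. ennreal (1 / max 1 (real k)) * indicator (D k) z) \<partial>plane_measure)"
    by (intro nn_integral_mono pt)
  also have "\<dots> = (\<Sum>k<n. ennreal (1 / max 1 (real k)))"
    by (subst nn_integral_sum) (auto simp: nn_integral_cmult_indicator D)
  also have "\<dots> = ennreal (\<Sum>k<n. 1 / max 1 (real k))" by (subst sum_ennreal) auto
  also have "\<dots> \<le> ennreal (2 + ln (real n))"
  proof (rule ennreal_leI)
    have "(\<Sum>k<n. 1 / max 1 (real k)) \<le> (\<Sum>k\<in>insert 0 {1..n}. 1 / max 1 (real k))"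
      by (intro sum_mono2) auto
    also have "\<dots> = 1 + (\<Sum>k = 1..n. 1 / real k)"
      by (subst sum.insert) (auto intro!: sum.cong simp: max_def)
    also have "\<dots> \<le> 2 + ln (real n)" using sum_inverse_le[OF n] by simp
    finally show "(\<Sum>k<n. 1 / max 1 (real k)) \<le> 2 + ln (real n)" .
  qed
  finally show ?thesis .
qed

lemma nn_integral_repulsion: "(\<integral>\<^sup>+v. ennreal (repulsion u v) \<partial>plane_measure) = 1"
proof -
  have "(\<integral>\<^sup>+v. ennreal (repulsion u v) \<partial>plane_measure) = (\<integral>\<^sup>+v. ennreal (repulsion u (u + v)) \<partial>plane_measure)"
    by (rule nn_integral_plane_translate[symmetric]) measurable
  also have "\<dots> = 1" using nn_integral_plane_gaussian[of 1] by (simp add: repulsion_def)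
  finally show ?thesis .
qed

lemma nn_integral_square_repulsion:
  "(\<integral>\<^sup>+v. ennreal ((cmod (u - v))\<^sup>2 * repulsion u v) \<partial>plane_measure) \<le> 4"
proof -
  have le: "x * exp (- x) \<le> 2 * exp (- (1 / 2) * x)" for x :: real
  proof -
    have "x / 2 \<le> exp (x / 2)" using exp_ge_add_one_self[of "x / 2"] by linarith
    then have "x * exp (- x) \<le> (2 * exp (x / 2)) * exp (- x)" by (intro mult_right_mono) auto
    moreover have "exp (x / 2) * exp (- x) = exp (- (1 / 2) * x)"
      by (subst exp_add[symmetric]) simp
    ultimately show ?thesis by (simp add: mult.assoc)
  qed
  have "(\<integral>\<^sup>+v. ennreal ((cmod (u - v))\<^sup>2 * repulsion u v) \<partial>plane_measure)
      = (\<integral>\<^sup>+v. ennreal ((cmod (u - (u + v)))\<^sup>2 * repulsion u (u + v)) \<partial>plane_measure)"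
    by (rule nn_integral_plane_translate[symmetric]) measurable
  also have "\<dots> \<le> (\<integral>\<^sup>+v. ennreal (2 * exp (- (1 / 2) * (cmod v)\<^sup>2)) \<partial>plane_measure)"
    unfolding repulsion_def by (intro nn_integral_mono ennreal_leI) (use le in simp)
  also have "\<dots> = ennreal 2 * (\<integral>\<^sup>+v. ennreal (exp (- (1 / 2) * (cmod v)\<^sup>2)) \<partial>plane_measure)"
    by (subst nn_integral_cmult[symmetric]) (auto simp: ennreal_mult' simp del: ennreal_numeral)
  also have "\<dots> = ennreal (2 * 2)"
    by (subst nn_integral_plane_gaussian) (auto simp flip: ennreal_mult simp del: ennreal_numeral)
  also have "\<dots> = 4" by simp
  finally show ?thesis .
qed

context ginibre
begin

definition linear_statistic :: "complex set \<Rightarrow> (complex \<Rightarrow> ennreal) \<Rightarrow> 'w \<Rightarrow> ennreal" where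
  "linear_statistic C \<phi> \<omega> = (\<integral>\<^sup>+x. \<phi> x \<partial>count_space (\<Lambda> \<omega> \<inter> C))"

lemma linear_statistic_cmult: "linear_statistic C (\<lambda>x. c * \<phi> x) \<omega> = c * linear_statistic C \<phi> \<omega>"
  unfolding linear_statistic_def by (rule nn_integral_cmult) simp

lemma linear_statistic_add:
  "linear_statistic C (\<lambda>x. \<phi> x + \<psi> x) \<omega> = linear_statistic C \<phi> \<omega> + linear_statistic C \<psi> \<omega>"
  unfolding linear_statistic_def by (rule nn_integral_add) auto

lemma linear_statistic_SUP:
  "incseq U \<Longrightarrow> linear_statistic C (SUP i. U i) \<omega> = (SUP i. linear_statistic C (U i) \<omega>)"
  unfolding linear_statistic_def SUP_apply
  by (rule nn_integral_monotone_convergence_SUP) auto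

lemma linear_statistic_mono: "\<phi> \<le> \<psi> \<Longrightarrow> linear_statistic C \<phi> \<omega> \<le> linear_statistic C \<psi> \<omega>"
  unfolding linear_statistic_def by (rule nn_integral_mono) (simp add: le_fun_def)

lemma linear_statistic_indicator:
  "linear_statistic C (indicator A) \<omega> = emeasure (count_space UNIV) (\<Lambda> \<omega> \<inter> (C \<inter> A))"
proof -
  have "linear_statistic C (indicator A) \<omega> = (\<integral>\<^sup>+x. indicator A x * indicator (\<Lambda> \<omega> \<inter> C) x \<partial>count_space UNIV)"
    unfolding linear_statistic_def by (subst nn_integral_count_space_indicator) auto
  also have "\<dots> = (\<integral>\<^sup>+x. indicator (\<Lambda> \<omega> \<inter> (C \<inter> A)) x \<partial>count_space UNIV)"
    by (intro nn_integral_cong) (auto split: split_indicator)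
  finally show ?thesis by simp
qed

lemma borel_measurable_linear_statistic:
  assumes "compact C" "\<phi> \<in> borel_measurable borel"
  shows "linear_statistic C \<phi> \<in> borel_measurable M"
  using assms(2)
proof (induction rule: borel_measurable_induct)
  case (cong f g)
  then have "f = g" by auto
  then show ?case using cong by simp
next
  case (set A)
  have "C \<inter> A \<in> sets borel" using set assms(1) by (auto intro: borel_compact)
  then show ?case unfolding linear_statistic_indicator[abs_def] by (rule measurable_count)
next
  case (mult u c)
  then show ?case by (simp add: linear_statistic_cmult[abs_def])
next
  case (add u v)
  then show ?case by (simp add: linear_statistic_add[abs_def])
next
  case (seq U)
  have "linear_statistic C (SUP i. U i) = (\<lambda>\<omega>. SUP i. linear_statistic C (U i) \<omega>)"
    using seq.hyps(3) by (auto simp: linear_statistic_SUP)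
  then show ?case using seq.IH by (simp only:) (intro borel_measurable_SUP, auto)
qed

lemma linear_statistic_moment:
  assumes C: "compact C" and w [measurable]: "w \<in> borel_measurable M" and W [measurable]: "W \<in> borel_measurable borel"
    and base: "\<And>A. A \<in> sets borel \<Longrightarrow>
      (\<integral>\<^sup>+\<omega>. linear_statistic C (indicator A) \<omega> * w \<omega> \<partial>M) = (\<integral>\<^sup>+u. indicator A u * W u \<partial>plane_measure)"
    and \<phi>: "\<phi> \<in> borel_measurable borel"
  shows "(\<integral>\<^sup>+\<omega>. linear_statistic C \<phi> \<omega> * w \<omega> \<partial>M) = (\<integral>\<^sup>+u. \<phi> u * W u \<partial>plane_measure)"
  using \<phi>
proof (induction rule: borel_measurable_induct)
  case (cong f g)
  then have "f = g" by auto
  then show ?case using cong by simp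
next
  case (set A)
  then show ?case by (rule base)
next
  case (mult u c)
  note [measurable] = mult.hyps(2) borel_measurable_linear_statistic[OF C mult.hyps(2)]
  show ?case
    by (simp add: linear_statistic_cmult mult.assoc nn_integral_cmult mult)
next
  case (add u v)
  note [measurable] = add.hyps(1,3)
    borel_measurable_linear_statistic[OF C add.hyps(1)] borel_measurable_linear_statistic[OF C add.hyps(3)]
  show ?case
    by (simp add: linear_statistic_add distrib_right nn_integral_add add)
next
  case (seq U)
  note [measurable] = seq.hyps(1) borel_measurable_linear_statistic[OF C seq.hyps(1)]
  have "(\<integral>\<^sup>+\<omega>. linear_statistic C (SUP i. U i) \<omega> * w \<omega> \<partial>M) = (\<integral>\<^sup>+\<omega>. (SUP i. linear_statistic C (U i) \<omega> * w \<omega>) \<partial>M)"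
    by (simp add: linear_statistic_SUP[OF seq.hyps(3)] SUP_mult_right_ennreal)
  also have "\<dots> = (SUP i. \<integral>\<^sup>+\<omega>. linear_statistic C (U i) \<omega> * w \<omega> \<partial>M)"
    by (rule nn_integral_monotone_convergence_SUP)
       (auto simp: incseq_def le_fun_def intro!: mult_right_mono linear_statistic_mono seq.hyps(3)[THEN incseqD, THEN le_funD])
  also have "\<dots> = (SUP i. \<integral>\<^sup>+u. U i u * W u \<partial>plane_measure)"
    by (simp add: seq)
  also have "\<dots> = (\<integral>\<^sup>+u. (SUP i. U i u * W u) \<partial>plane_measure)"
    by (rule nn_integral_monotone_convergence_SUP[symmetric])
       (auto simp: incseq_def le_fun_def intro!: mult_right_mono seq.hyps(3)[THEN incseqD, THEN le_funD])
  also have "\<dots> = (\<integral>\<^sup>+u. (SUP i. U i) u * W u \<partial>plane_measure)"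
    by (simp only: SUP_apply SUP_mult_right_ennreal)
  finally show ?case .
qed

lemma nn_integral_linear_statistic:
  assumes C: "compact C" and \<phi>: "\<phi> \<in> borel_measurable borel"
  shows "(\<integral>\<^sup>+\<omega>. linear_statistic C \<phi> \<omega> \<partial>M) = (\<integral>\<^sup>+u. \<phi> u * indicator C u \<partial>plane_measure)"
proof -
  have [measurable]: "C \<in> sets borel" using C by (rule borel_compact)
  have "(\<integral>\<^sup>+\<omega>. linear_statistic C \<phi> \<omega> * 1 \<partial>M) = (\<integral>\<^sup>+u. \<phi> u * indicator C u \<partial>plane_measure)"
  proof (rule linear_statistic_moment[OF C _ _ _ \<phi>])
    fix A :: "complex set" assume [measurable]: "A \<in> sets borel"
    have "(\<integral>\<^sup>+\<omega>. linear_statistic C (indicator A) \<omega> * 1 \<partial>M) = emeasure plane_measure (C \<inter> A)"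
      unfolding linear_statistic_indicator mult_1_right by (rule first_intensity) measurable
    also have "\<dots> = (\<integral>\<^sup>+u. indicator (C \<inter> A) u \<partial>plane_measure)" by simp
    also have "\<dots> = (\<integral>\<^sup>+u. indicator A u * indicator C u \<partial>plane_measure)"
      by (intro nn_integral_cong) (auto split: split_indicator)
    finally show "(\<integral>\<^sup>+\<omega>. linear_statistic C (indicator A) \<omega> * 1 \<partial>M) = (\<integral>\<^sup>+u. indicator A u * indicator C u \<partial>plane_measure)" .
  qed auto
  then show ?thesis by simp
qed

definition pair_weight :: "complex set \<Rightarrow> (complex \<Rightarrow> ennreal) \<Rightarrow> complex \<Rightarrow> ennreal" where
  "pair_weight C \<psi> u = indicator C u *
    ((\<integral>\<^sup>+v. \<psi> v * indicator C v * ennreal (1 - repulsion u v) \<partial>plane_measure) + \<psi> u)"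

lemma borel_measurable_pair_weight:
  assumes [measurable]: "C \<in> sets borel" "\<psi> \<in> borel_measurable borel"
  shows "pair_weight C \<psi> \<in> borel_measurable borel"
  unfolding pair_weight_def[abs_def] by measurable

lemma nn_integral_pair_weight:
  assumes [measurable]: "C \<in> sets borel" "\<phi> \<in> borel_measurable borel" "\<psi> \<in> borel_measurable borel"
  shows "(\<integral>\<^sup>+u. \<phi> u * pair_weight C \<psi> u \<partial>plane_measure) =
    (\<integral>\<^sup>+u. \<integral>\<^sup>+v. \<phi> u * indicator C u * (\<psi> v * indicator C v) * ennreal (1 - repulsion u v) \<partial>plane_measure \<partial>plane_measure)
    + (\<integral>\<^sup>+u. \<phi> u * \<psi> u * indicator C u \<partial>plane_measure)"
proof -
  have "\<phi> u * pair_weight C \<psi> u =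
    (\<integral>\<^sup>+v. \<phi> u * indicator C u * (\<psi> v * indicator C v) * ennreal (1 - repulsion u v) \<partial>plane_measure)
      + \<phi> u * \<psi> u * indicator C u" for u
  proof -
    have "(\<integral>\<^sup>+v. \<phi> u * indicator C u * (\<psi> v * indicator C v) * ennreal (1 - repulsion u v) \<partial>plane_measure)
      = \<phi> u * indicator C u * (\<integral>\<^sup>+v. \<psi> v * indicator C v * ennreal (1 - repulsion u v) \<partial>plane_measure)"
      by (subst nn_integral_cmult[symmetric]) (auto simp: mult.assoc)
    then show ?thesis by (simp add: pair_weight_def distrib_left mult_ac)
  qed
  then show ?thesis by (simp add: nn_integral_add)
qed

lemma nn_integral_pair_weight_commute:
  assumes [measurable]: "C \<in> sets borel" "\<phi> \<in> borel_measurable borel" "\<psi> \<in> borel_measurable borel"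
  shows "(\<integral>\<^sup>+u. \<phi> u * pair_weight C \<psi> u \<partial>plane_measure) = (\<integral>\<^sup>+u. \<psi> u * pair_weight C \<phi> u \<partial>plane_measure)"
proof -
  have "(\<integral>\<^sup>+u. \<integral>\<^sup>+v. \<phi> u * indicator C u * (\<psi> v * indicator C v) * ennreal (1 - repulsion u v) \<partial>plane_measure \<partial>plane_measure)
    = (\<integral>\<^sup>+v. \<integral>\<^sup>+u. \<phi> u * indicator C u * (\<psi> v * indicator C v) * ennreal (1 - repulsion u v) \<partial>plane_measure \<partial>plane_measure)"
    by (rule plane_pair.Fubini'[symmetric]) measurable
  then show ?thesis
    unfolding nn_integral_pair_weight[OF assms] nn_integral_pair_weight[OF assms(1,3,2)]
    by (simp add: mult_ac repulsion_commute)
qed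

lemma linear_statistic_indicator_mult:
  assumes C: "compact C" and \<omega>: "\<omega> \<in> space M"
  shows "linear_statistic C (indicator A) \<omega> < \<infinity>"
    and "linear_statistic C (indicator A) \<omega> * linear_statistic C (indicator B) \<omega> =
      emeasure (count_space UNIV) ((\<Lambda> \<omega> \<inter> (C \<inter> A)) \<times> (\<Lambda> \<omega> \<inter> (C \<inter> B)) - Id)
      + linear_statistic C (indicator (A \<inter> B)) \<omega>"
proof -
  let ?X = "\<Lambda> \<omega> \<inter> (C \<inter> A)" and ?Y = "\<Lambda> \<omega> \<inter> (C \<inter> B)"
  have fin: "finite ?X" "finite ?Y"
    by (rule finite_subset[OF _ locally_finite[OF \<omega> C]], blast)+
  then show "linear_statistic C (indicator A) \<omega> < \<infinity>"
    by (simp add: linear_statistic_indicator of_nat_less_top)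
  have "card (?X \<times> ?Y) = card (?X \<times> ?Y - Id) + card (?X \<times> ?Y \<inter> Id)"
    using card_Int_Diff[of "?X \<times> ?Y" Id] fin by simp
  also have "?X \<times> ?Y \<inter> Id = (\<lambda>x. (x, x)) ` (\<Lambda> \<omega> \<inter> (C \<inter> (A \<inter> B)))" by auto
  also have "card \<dots> = card (\<Lambda> \<omega> \<inter> (C \<inter> (A \<inter> B)))" by (rule card_image) (auto simp: inj_on_def)
  finally have "card ?X * card ?Y = card (?X \<times> ?Y - Id) + card (\<Lambda> \<omega> \<inter> (C \<inter> (A \<inter> B)))"
    by (simp add: card_cartesian_product)
  moreover have "finite (\<Lambda> \<omega> \<inter> (C \<inter> (A \<inter> B)))"
    by (rule finite_subset[OF _ fin(1)]) blast
  ultimately show "linear_statistic C (indicator A) \<omega> * linear_statistic C (indicator B) \<omega> =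
      emeasure (count_space UNIV) (?X \<times> ?Y - Id) + linear_statistic C (indicator (A \<inter> B)) \<omega>"
    using fin by (simp add: linear_statistic_indicator flip: of_nat_mult of_nat_add)
qed

lemma nn_integral_linear_statistic_indicator_mult:
  assumes C: "compact C" and [measurable]: "A \<in> sets borel" "B \<in> sets borel"
  shows "(\<integral>\<^sup>+\<omega>. linear_statistic C (indicator A) \<omega> * linear_statistic C (indicator B) \<omega> \<partial>M)
    = (\<integral>\<^sup>+u. indicator A u * pair_weight C (indicator B) u \<partial>plane_measure)"
proof -
  let ?S = "\<lambda>A. linear_statistic C (indicator A)"
  let ?p = "\<lambda>\<omega>. emeasure (count_space UNIV) ((\<Lambda> \<omega> \<inter> (C \<inter> A)) \<times> (\<Lambda> \<omega> \<inter> (C \<inter> B)) - Id)"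
  have C' [measurable]: "C \<in> sets borel" using C by (rule borel_compact)
  have [measurable]: "?S A \<in> borel_measurable M" if "A \<in> sets borel" for A
    using that C by (intro borel_measurable_linear_statistic) auto
  have "?p \<omega> = ?S A \<omega> * ?S B \<omega> - ?S (A \<inter> B) \<omega>" if "\<omega> \<in> space M" for \<omega>
    using linear_statistic_indicator_mult(2)[OF C that, of A B] linear_statistic_indicator_mult(1)[OF C that, of "A \<inter> B"]
    by simp
  moreover have "(\<lambda>\<omega>. ?S A \<omega> * ?S B \<omega> - ?S (A \<inter> B) \<omega>) \<in> borel_measurable M" by measurable
  ultimately have [measurable]: "?p \<in> borel_measurable M" by (subst measurable_cong)
  have "(\<integral>\<^sup>+\<omega>. ?S A \<omega> * ?S B \<omega> \<partial>M) = (\<integral>\<^sup>+\<omega>. ?p \<omega> + ?S (A \<inter> B) \<omega> \<partial>M)"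
    by (intro nn_integral_cong linear_statistic_indicator_mult(2)[OF C])
  also have "\<dots> = (\<integral>\<^sup>+\<omega>. ?p \<omega> \<partial>M) + (\<integral>\<^sup>+\<omega>. ?S (A \<inter> B) \<omega> \<partial>M)"
    by (rule nn_integral_add) measurable
  also have "(\<integral>\<^sup>+\<omega>. ?p \<omega> \<partial>M) = (\<integral>\<^sup>+u. \<integral>\<^sup>+v. indicator (C \<inter> A) u * indicator (C \<inter> B) v * ennreal (1 - repulsion u v) \<partial>plane_measure \<partial>plane_measure)"
    by (rule second_intensity) measurable
  also have "(\<integral>\<^sup>+\<omega>. ?S (A \<inter> B) \<omega> \<partial>M) = (\<integral>\<^sup>+u. indicator (A \<inter> B) u * indicator C u \<partial>plane_measure)"
    by (rule nn_integral_linear_statistic[OF C]) measurable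
  finally show ?thesis
    by (subst nn_integral_pair_weight) (simp_all add: indicator_inter_arith mult_ac)
qed

lemma nn_integral_linear_statistic_mult:
  assumes C: "compact C" and [measurable]: "\<phi> \<in> borel_measurable borel" "\<psi> \<in> borel_measurable borel"
  shows "(\<integral>\<^sup>+\<omega>. linear_statistic C \<phi> \<omega> * linear_statistic C \<psi> \<omega> \<partial>M)
    = (\<integral>\<^sup>+u. \<phi> u * pair_weight C \<psi> u \<partial>plane_measure)"
proof -
  have [measurable]: "C \<in> sets borel" using C by (rule borel_compact)
  note [measurable] = borel_measurable_pair_weight borel_measurable_linear_statistic[OF C]
  have ind: "(\<integral>\<^sup>+\<omega>. linear_statistic C \<phi> \<omega> * linear_statistic C (indicator B) \<omega> \<partial>M)
      = (\<integral>\<^sup>+u. \<phi> u * pair_weight C (indicator B) u \<partial>plane_measure)" if [measurable]: "B \<in> sets borel" for B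
    by (rule linear_statistic_moment[OF C]) (auto intro!: nn_integral_linear_statistic_indicator_mult[OF C])
  have "(\<integral>\<^sup>+\<omega>. linear_statistic C \<psi> \<omega> * linear_statistic C \<phi> \<omega> \<partial>M)
      = (\<integral>\<^sup>+u. \<psi> u * pair_weight C \<phi> u \<partial>plane_measure)"
  proof (rule linear_statistic_moment[OF C])
    fix B :: "complex set" assume [measurable]: "B \<in> sets borel"
    show "(\<integral>\<^sup>+\<omega>. linear_statistic C (indicator B) \<omega> * linear_statistic C \<phi> \<omega> \<partial>M)
      = (\<integral>\<^sup>+u. indicator B u * pair_weight C \<phi> u \<partial>plane_measure)"
      using ind[of B] by (subst nn_integral_pair_weight_commute) (simp_all add: mult.commute)
  qed measurable
  then show ?thesis
    by (subst nn_integral_pair_weight_commute) (simp_all add: mult.commute)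
qed

end

context ginibre
begin

abbreviation log_stat :: "nat \<Rightarrow> 'w \<Rightarrow> real" where
  "log_stat n \<omega> \<equiv> log_statistic n (\<Lambda> \<omega>)"

lemma finite_points_disc:
  assumes "\<omega> \<in> space M"
  shows "finite (\<Lambda> \<omega> \<inter> {z. (cmod z)\<^sup>2 < t})"
proof (rule finite_subset[OF _ locally_finite[OF assms compact_cball[of 0 "sqrt t"]]])
  show "\<Lambda> \<omega> \<inter> {z. (cmod z)\<^sup>2 < t} \<subseteq> \<Lambda> \<omega> \<inter> cball 0 (sqrt t)"
    by (auto simp: real_le_rsqrt less_imp_le)
qed

lemma log_weight_cball:
  assumes "n \<ge> 1"
  shows "ennreal (log_weight n u) * indicator (cball 0 (sqrt (real n))) u = ennreal (log_weight n u)"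
proof (cases "u \<in> cball 0 (sqrt (real n))")
  case False
  then have "sqrt (real n) < cmod u" by simp
  then have "real n \<le> (cmod u)\<^sup>2" by (simp add: real_less_lsqrt sqrt_le_D less_imp_le)
  then show ?thesis using log_weight_eq_0[OF assms] by simp
qed simp

lemma linear_statistic_log_weight:
  assumes \<omega>: "\<omega> \<in> space M" and n: "n \<ge> 1"
  shows "linear_statistic (cball 0 (sqrt (real n))) (\<lambda>z. ennreal (log_weight n z)) \<omega> = ennreal (log_stat n \<omega>)"
proof -
  let ?C = "cball 0 (sqrt (real n)) :: complex set"
  have fin: "finite (\<Lambda> \<omega> \<inter> ?C)" by (rule locally_finite[OF \<omega> compact_cball])
  have "linear_statistic ?C (\<lambda>z. ennreal (log_weight n z)) \<omega> = (\<Sum>z\<in>\<Lambda> \<omega> \<inter> ?C. ennreal (log_weight n z))"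
    unfolding linear_statistic_def by (rule nn_integral_count_space_finite[OF fin])
  also have "\<dots> = ennreal (\<Sum>z\<in>\<Lambda> \<omega> \<inter> ?C. log_weight n z)"
    by (rule sum_ennreal) simp
  also have "(\<Sum>z\<in>\<Lambda> \<omega> \<inter> ?C. log_weight n z) = log_stat n \<omega>"
    unfolding log_statistic_def
  proof (rule sum.mono_neutral_right[OF fin])
    show "\<Lambda> \<omega> \<inter> {z. (cmod z)\<^sup>2 < real n} \<subseteq> \<Lambda> \<omega> \<inter> ?C"
      by (auto simp: real_le_rsqrt less_imp_le)
    show "\<forall>z\<in>\<Lambda> \<omega> \<inter> ?C - \<Lambda> \<omega> \<inter> {z. (cmod z)\<^sup>2 < real n}. log_weight n z = 0"
      using log_weight_eq_0[OF n] by (auto simp: not_less)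
  qed
  finally show ?thesis .
qed

lemma log_stat_nonneg: "0 \<le> log_stat n \<omega>"
  unfolding log_statistic_def by (intro sum_nonneg) auto

lemma borel_measurable_log_stat [measurable]:
  assumes n: "n \<ge> 1"
  shows "log_stat n \<in> borel_measurable M"
proof -
  have "(\<lambda>\<omega>. enn2real (linear_statistic (cball 0 (sqrt (real n))) (\<lambda>z. ennreal (log_weight n z)) \<omega>)) \<in> borel_measurable M"
    by (intro borel_measurable_enn2real borel_measurable_linear_statistic compact_cball) measurable
  then show ?thesis
    by (rule measurable_cong[THEN iffD1, rotated])
       (simp add: linear_statistic_log_weight[OF _ n] log_stat_nonneg)
qed

lemma nn_integral_log_stat:
  assumes n: "n \<ge> 1"
  shows "(\<integral>\<^sup>+\<omega>. ennreal (log_stat n \<omega>) \<partial>M) = ennreal (real n - 1)"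
proof -
  have "(\<integral>\<^sup>+\<omega>. ennreal (log_stat n \<omega>) \<partial>M)
      = (\<integral>\<^sup>+\<omega>. linear_statistic (cball 0 (sqrt (real n))) (\<lambda>z. ennreal (log_weight n z)) \<omega> \<partial>M)"
    by (intro nn_integral_cong linear_statistic_log_weight[OF _ n, symmetric])
  also have "\<dots> = (\<integral>\<^sup>+u. ennreal (log_weight n u) * indicator (cball 0 (sqrt (real n))) u \<partial>plane_measure)"
    by (rule nn_integral_linear_statistic) auto
  finally show ?thesis unfolding log_weight_cball[OF n] nn_integral_log_weight[OF n] .
qed

lemma nn_integral_log_stat_square:
  assumes n: "n \<ge> 1"
  shows "(\<integral>\<^sup>+\<omega>. ennreal ((log_stat n \<omega>)\<^sup>2) \<partial>M) \<le> ennreal ((real n - 1)\<^sup>2 + 16 * (2 + ln (real n)))"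
proof -
  let ?C = "cball 0 (sqrt (real n)) :: complex set"
  let ?f = "log_weight n"
  let ?\<phi> = "\<lambda>z. ennreal (?f z)"
  let ?I = "\<lambda>F. \<integral>\<^sup>+u. \<integral>\<^sup>+v. F u v \<partial>plane_measure \<partial>plane_measure"
  define E where "E = (\<integral>\<^sup>+\<omega>. ennreal ((log_stat n \<omega>)\<^sup>2) \<partial>M)"
  define P where "P = ?I (\<lambda>u v. ennreal (?f u * ?f v * (1 - repulsion u v)))"
  define Q where "Q = ?I (\<lambda>u v. ennreal (?f u * ?f v * repulsion u v))"
  define V where "V = ?I (\<lambda>u v. ennreal ((?f u - ?f v)\<^sup>2 * repulsion u v))"
  define S where "S = (\<integral>\<^sup>+u. ennreal ((?f u)\<^sup>2) \<partial>plane_measure)"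
  have E: "E = P + S"
  proof -
    have "E = (\<integral>\<^sup>+\<omega>. linear_statistic ?C ?\<phi> \<omega> * linear_statistic ?C ?\<phi> \<omega> \<partial>M)"
      unfolding E_def by (intro nn_integral_cong)
        (simp add: linear_statistic_log_weight[OF _ n] log_stat_nonneg power2_eq_square ennreal_mult)
    also have "\<dots> = (\<integral>\<^sup>+u. ?\<phi> u * pair_weight ?C ?\<phi> u \<partial>plane_measure)"
      by (rule nn_integral_linear_statistic_mult) auto
    also have "\<dots> = ?I (\<lambda>u v. ?\<phi> u * indicator ?C u * (?\<phi> v * indicator ?C v) * ennreal (1 - repulsion u v))
        + (\<integral>\<^sup>+u. ?\<phi> u * ?\<phi> u * indicator ?C u \<partial>plane_measure)"
      by (rule nn_integral_pair_weight) auto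
    also have "\<dots> = P + S"
      unfolding P_def S_def mult.assoc[of "?\<phi> _" "?\<phi> _"] log_weight_cball[OF n]
      using repulsion_le_1 by (simp add: ennreal_mult power2_eq_square mult.assoc)
    finally show ?thesis .
  qed
  have "P + Q = ?I (\<lambda>u v. ennreal (?f u) * ennreal (?f v))"
  proof -
    have "P + Q = ?I (\<lambda>u v. ennreal (?f u * ?f v * (1 - repulsion u v)) + ennreal (?f u * ?f v * repulsion u v))"
      unfolding P_def Q_def by (subst nn_integral_add[symmetric], measurable, subst nn_integral_add[symmetric], measurable)
    also have "\<dots> = ?I (\<lambda>u v. ennreal (?f u) * ennreal (?f v))"
    proof (intro nn_integral_cong)
      fix u v
      have "0 \<le> ?f u * ?f v * (1 - repulsion u v)" "0 \<le> ?f u * ?f v * repulsion u v"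
        using repulsion_le_1[of u v] repulsion_pos[of u v] by (auto intro!: mult_nonneg_nonneg)
      then show "ennreal (?f u * ?f v * (1 - repulsion u v)) + ennreal (?f u * ?f v * repulsion u v)
          = ennreal (?f u) * ennreal (?f v)"
        by (subst ennreal_plus[symmetric]) (simp_all add: algebra_simps flip: ennreal_mult)
    qed
    finally show ?thesis .
  qed
  also have "\<dots> = ennreal (real n - 1) * ennreal (real n - 1)"
    by (simp add: nn_integral_cmult nn_integral_multc nn_integral_log_weight[OF n])
  finally have PQ: "P + Q = ennreal ((real n - 1)\<^sup>2)"
    using n by (simp add: power2_eq_square ennreal_mult)
  have SS: "S + S = Q + Q + V"
  proof -
    have S1: "?I (\<lambda>u v. ennreal ((?f u)\<^sup>2 * repulsion u v)) = S"
      unfolding S_def using repulsion_pos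
      by (simp add: ennreal_mult less_imp_le nn_integral_cmult nn_integral_repulsion)
    have "?I (\<lambda>u v. ennreal ((?f v)\<^sup>2 * repulsion u v)) = ?I (\<lambda>v u. ennreal ((?f v)\<^sup>2 * repulsion u v))"
      by (rule plane_pair.Fubini') measurable
    then have S2: "?I (\<lambda>u v. ennreal ((?f v)\<^sup>2 * repulsion u v)) = S"
      using S1 by (simp add: repulsion_commute)
    have "S + S = ?I (\<lambda>u v. ennreal ((?f u)\<^sup>2 * repulsion u v) + ennreal ((?f v)\<^sup>2 * repulsion u v))"
      by (subst (1) S1[symmetric], subst (1) S2[symmetric],
          subst nn_integral_add[symmetric], measurable, subst nn_integral_add[symmetric], measurable)
    also have "\<dots> = ?I (\<lambda>u v. ennreal (?f u * ?f v * repulsion u v) + ennreal (?f u * ?f v * repulsion u v)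
        + ennreal ((?f u - ?f v)\<^sup>2 * repulsion u v))"
    proof (intro nn_integral_cong)
      fix u v
      define a b c d where "a = (?f u)\<^sup>2 * repulsion u v" and "b = (?f v)\<^sup>2 * repulsion u v"
        and "c = ?f u * ?f v * repulsion u v" and "d = (?f u - ?f v)\<^sup>2 * repulsion u v"
      have nonneg: "0 \<le> a" "0 \<le> b" "0 \<le> c" "0 \<le> d"
        using repulsion_pos[of u v] by (auto simp: a_def b_def c_def d_def)
      have "a + b = c + c + d"
        by (simp add: a_def b_def c_def d_def algebra_simps power2_eq_square)
      then have "ennreal a + ennreal b = ennreal c + ennreal c + ennreal d"
        using nonneg by (metis ennreal_plus add_nonneg_nonneg)
      then show "ennreal ((?f u)\<^sup>2 * repulsion u v) + ennreal ((?f v)\<^sup>2 * repulsion u v)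
        = ennreal (?f u * ?f v * repulsion u v) + ennreal (?f u * ?f v * repulsion u v)
        + ennreal ((?f u - ?f v)\<^sup>2 * repulsion u v)"
        by (simp only: a_def b_def c_def d_def)
    qed
    also have "\<dots> = Q + Q + V"
      unfolding Q_def V_def
      by (subst nn_integral_add, measurable, subst nn_integral_add, measurable,
          subst nn_integral_add, measurable, subst nn_integral_add, measurable)
    finally show ?thesis .
  qed
  have V: "V \<le> ennreal (32 * (2 + ln (real n)))"
  proof -
    let ?w = "log_gradient n"
    let ?r = "\<lambda>u v. (cmod (u - v))\<^sup>2 * repulsion u v"
    have r0: "0 \<le> ?r u v" for u v using repulsion_pos[of u v] by simp
    have W1: "?I (\<lambda>u v. ennreal (?w u) * ennreal (?r u v)) \<le> ennreal (2 + ln (real n)) * 4"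
    proof -
      have "?I (\<lambda>u v. ennreal (?w u) * ennreal (?r u v)) = (\<integral>\<^sup>+u. ennreal (?w u) * (\<integral>\<^sup>+v. ennreal (?r u v) \<partial>plane_measure) \<partial>plane_measure)"
        by (intro nn_integral_cong nn_integral_cmult) measurable
      also have "\<dots> \<le> (\<integral>\<^sup>+u. ennreal (?w u) * 4 \<partial>plane_measure)"
        by (intro nn_integral_mono mult_left_mono nn_integral_square_repulsion) auto
      also have "\<dots> = (\<integral>\<^sup>+u. ennreal (?w u) \<partial>plane_measure) * 4"
        by (rule nn_integral_multc) measurable
      also have "\<dots> \<le> ennreal (2 + ln (real n)) * 4"
        by (intro mult_right_mono nn_integral_log_gradient n) auto
      finally show ?thesis .
    qed
    have "?I (\<lambda>u v. ennreal (?w v) * ennreal (?r u v)) = ?I (\<lambda>v u. ennreal (?w v) * ennreal (?r u v))"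
      by (rule plane_pair.Fubini') measurable
    then have W2: "?I (\<lambda>u v. ennreal (?w v) * ennreal (?r u v)) \<le> ennreal (2 + ln (real n)) * 4"
      using W1 by (simp add: repulsion_commute norm_minus_commute)
    have "V \<le> ?I (\<lambda>u v. ennreal 4 * (ennreal (?w u) * ennreal (?r u v) + ennreal (?w v) * ennreal (?r u v)))"
      unfolding V_def
    proof (intro nn_integral_mono)
      fix u v
      have "(?f u - ?f v)\<^sup>2 * repulsion u v \<le> (4 * (cmod (u - v))\<^sup>2 * (?w u + ?w v)) * repulsion u v"
        by (intro mult_right_mono log_weight_diff_square_le n) (simp add: repulsion_pos less_imp_le)
      also have "\<dots> = 4 * (?w u * ?r u v + ?w v * ?r u v)" by (simp add: algebra_simps)
      finally have "ennreal ((?f u - ?f v)\<^sup>2 * repulsion u v) \<le> ennreal (4 * (?w u * ?r u v + ?w v * ?r u v))"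
        by (rule ennreal_leI)
      also have "\<dots> = ennreal 4 * (ennreal (?w u) * ennreal (?r u v) + ennreal (?w v) * ennreal (?r u v))"
        using r0 by (simp add: ennreal_mult ennreal_plus distrib_left del: ennreal_numeral)
      finally show "ennreal ((?f u - ?f v)\<^sup>2 * repulsion u v)
        \<le> ennreal 4 * (ennreal (?w u) * ennreal (?r u v) + ennreal (?w v) * ennreal (?r u v))" .
    qed
    also have "\<dots> = ennreal 4 * (?I (\<lambda>u v. ennreal (?w u) * ennreal (?r u v)) + ?I (\<lambda>u v. ennreal (?w v) * ennreal (?r u v)))"
      by (subst nn_integral_cmult, measurable, subst nn_integral_cmult, measurable,
          subst nn_integral_add, measurable, subst nn_integral_add, measurable)
    also have "\<dots> \<le> ennreal 4 * (ennreal (2 + ln (real n)) * 4 + ennreal (2 + ln (real n)) * 4)"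
      by (intro mult_left_mono add_mono W1 W2) auto
    also have "\<dots> = ennreal 4 * (ennreal (2 + ln (real n)) * ennreal 4 + ennreal (2 + ln (real n)) * ennreal 4)"
      by simp
    also have "\<dots> = ennreal (4 * ((2 + ln (real n)) * 4 + (2 + ln (real n)) * 4))"
      using n by (simp add: ennreal_mult[symmetric] ennreal_plus[symmetric] del: ennreal_numeral ennreal_plus)
    finally show ?thesis by (simp add: algebra_simps)
  qed
  have Q: "Q \<le> ennreal ((real n - 1)\<^sup>2)" unfolding PQ[symmetric] by simp
  obtain q where q: "Q = ennreal q" "q \<ge> 0"
    using Q by (cases Q rule: ennreal_cases) (auto simp: top_unique)
  obtain p where p: "P = ennreal p" "p \<ge> 0"
    using PQ by (cases P rule: ennreal_cases) auto
  obtain x where x: "V = ennreal x" "x \<ge> 0"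
    using V by (cases V rule: ennreal_cases) (auto simp: top_unique)
  have "S + S < \<infinity>"
    unfolding SS q x by simp
  then obtain s where s: "S = ennreal s" "s \<ge> 0"
    by (cases S rule: ennreal_cases) auto
  have "p + q = (real n - 1)\<^sup>2"
    using PQ unfolding p q using p q by (simp add: ennreal_plus[symmetric] del: ennreal_plus)
  moreover have "s + s = q + q + x"
    using SS unfolding s q x using s q x by (simp add: ennreal_plus[symmetric] del: ennreal_plus)
  moreover have "x \<le> 32 * (2 + ln (real n))"
    using V n unfolding x by (subst (asm) ennreal_le_iff) auto
  ultimately have "p + s \<le> (real n - 1)\<^sup>2 + 16 * (2 + ln (real n))" by linarith
  then show ?thesis
    unfolding E_def[symmetric] E p s using p s by (simp add: ennreal_plus[symmetric] ennreal_leI del: ennreal_plus)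
qed

lemma prob_log_stat_small:
  assumes n: "n \<ge> 1" "ln (real n) > 1"
  shows "prob {\<omega> \<in> space M. log_stat n \<omega> - real n < - ln (real n)} \<le> 16 * (2 + ln (real n)) / (ln (real n) - 1)\<^sup>2"
proof -
  note [measurable] = borel_measurable_log_stat[OF n(1)]
  have fin: "(\<integral>\<^sup>+\<omega>. ennreal ((log_stat n \<omega>)\<^sup>2) \<partial>M) < \<infinity>"
    using nn_integral_log_stat_square[OF n(1)] by (rule le_less_trans) simp
  have int2: "integrable M (\<lambda>\<omega>. (log_stat n \<omega>)\<^sup>2)"
    using fin by (intro integrableI_bounded) auto
  have int1: "integrable M (log_stat n)"
    by (rule square_integrable_imp_integrable[OF _ int2]) measurable
  have m: "expectation (log_stat n) = real n - 1"
    using n by (subst integral_eq_nn_integral) (auto simp: log_stat_nonneg nn_integral_log_stat)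
  have "expectation (\<lambda>\<omega>. (log_stat n \<omega>)\<^sup>2) \<le> (real n - 1)\<^sup>2 + 16 * (2 + ln (real n))"
  proof (subst integral_eq_nn_integral)
    show "enn2real (\<integral>\<^sup>+\<omega>. ennreal ((log_stat n \<omega>)\<^sup>2) \<partial>M) \<le> (real n - 1)\<^sup>2 + 16 * (2 + ln (real n))"
      using nn_integral_log_stat_square[OF n(1)] n by (intro enn2real_leI) auto
  qed auto
  then have var: "variance (log_stat n) \<le> 16 * (2 + ln (real n))"
    using variance_eq[OF int1 int2] m by simp
  have "prob {\<omega> \<in> space M. log_stat n \<omega> - real n < - ln (real n)}
      \<le> prob {\<omega> \<in> space M. \<bar>log_stat n \<omega> - expectation (log_stat n)\<bar> \<ge> ln (real n) - 1}"
    unfolding m by (intro finite_measure_mono) auto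
  also have "\<dots> \<le> variance (log_stat n) / (ln (real n) - 1)\<^sup>2"
    using n int2 by (intro Chebyshev_inequality) auto
  also have "\<dots> \<le> 16 * (2 + ln (real n)) / (ln (real n) - 1)\<^sup>2"
    using var by (intro divide_right_mono) auto
  finally show ?thesis .
qed

lemma prob_log_stat_small_tendsto:
  "(\<lambda>n. prob {\<omega> \<in> space M. log_stat n \<omega> - real n < - ln (real n)}) \<longlonglongrightarrow> 0"
proof (rule tendsto_sandwich[where f = "\<lambda>_. 0" and h = "\<lambda>n. 16 * (2 + ln (real n)) / (ln (real n) - 1)\<^sup>2"])
  show "(\<lambda>n. 16 * (2 + ln (real n)) / (ln (real n) - 1)\<^sup>2) \<longlonglongrightarrow> 0" by real_asymp
  have "eventually (\<lambda>n. ln (real n) > 1) sequentially" by real_asymp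
  with eventually_ge_at_top[of 1] show "eventually (\<lambda>n. prob {\<omega> \<in> space M. log_stat n \<omega> - real n < - ln (real n)}
      \<le> 16 * (2 + ln (real n)) / (ln (real n) - 1)\<^sup>2) sequentially"
    by eventually_elim (rule prob_log_stat_small)
qed auto

lemma prob_log_stat_sum_bounded:
  "prob {\<omega> \<in> space M. \<forall>N. (\<Sum>n = 1..N. exp (log_stat n \<omega> - real n)) \<le> C} = 0"
proof (rule ccontr)
  note [measurable] = borel_measurable_log_stat
  define A where "A = {\<omega> \<in> space M. \<forall>N. (\<Sum>n = 1..N. exp (log_stat n \<omega> - real n)) \<le> C}"
  have "(\<lambda>\<omega>. \<Sum>n = 1..N. exp (log_stat n \<omega> - real n)) \<in> borel_measurable M" for N
    by (intro borel_measurable_sum borel_measurable_exp borel_measurable_diff) auto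
  then have A [measurable]: "A \<in> sets M" unfolding A_def by measurable
  assume "prob {\<omega> \<in> space M. \<forall>N. (\<Sum>n = 1..N. exp (log_stat n \<omega> - real n)) \<le> C} \<noteq> 0"
  then have p: "prob A > 0" unfolding A_def[symmetric] using measure_nonneg[of M A] by linarith
  define B where "B n = {\<omega> \<in> space M. log_stat n \<omega> - real n < - ln (real n)}" for n
  have B: "B n \<in> sets M" if "n \<ge> 1" for n unfolding B_def using that by measurable
  obtain n0 where n0: "\<And>n. n \<ge> n0 \<Longrightarrow> prob (B n) < prob A / 2"
    using order_tendstoD(2)[OF prob_log_stat_small_tendsto, of "prob A / 2"] p
    unfolding B_def[symmetric] eventually_sequentially by auto
  define n1 where "n1 = max 1 n0"
  have "(\<Sum>n = n1..N. prob A / 2 * (1 / real n)) \<le> C" for N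
  proof -
    have "ennreal (\<Sum>n = n1..N. prob A / 2 * (1 / real n)) = (\<Sum>n = n1..N. ennreal (1 / real n) * ennreal (prob A / 2))"
      using p by (subst sum_ennreal[symmetric]) (auto simp: ennreal_mult[symmetric] mult.commute)
    also have "\<dots> \<le> (\<Sum>n = n1..N. ennreal (1 / real n) * emeasure M (A - B n))"
    proof (intro sum_mono mult_left_mono)
      fix n assume n: "n \<in> {n1..N}"
      then have n': "n \<ge> 1" "n \<ge> n0" by (auto simp: n1_def)
      have "prob A \<le> prob ((A - B n) \<union> B n)" using B[OF n'(1)] by (intro finite_measure_mono) auto
      also have "\<dots> \<le> prob (A - B n) + prob (B n)" using B[OF n'(1)] by (intro measure_Un_le) auto
      finally have "prob A / 2 \<le> prob (A - B n)" using n0[OF n'(2)] by linarith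
      then show "ennreal (prob A / 2) \<le> emeasure M (A - B n)"
        by (simp add: emeasure_eq_measure ennreal_leI)
    qed auto
    also have "\<dots> = (\<integral>\<^sup>+\<omega>. (\<Sum>n = n1..N. ennreal (1 / real n) * indicator (A - B n) \<omega>) \<partial>M)"
      using B A by (subst nn_integral_sum) (auto simp: n1_def nn_integral_cmult_indicator)
    also have "\<dots> \<le> (\<integral>\<^sup>+\<omega>. ennreal C * indicator A \<omega> \<partial>M)"
    proof (intro nn_integral_mono)
      fix \<omega> assume \<omega>: "\<omega> \<in> space M"
      show "(\<Sum>n = n1..N. ennreal (1 / real n) * indicator (A - B n) \<omega>) \<le> ennreal C * indicator A \<omega>"
      proof (cases "\<omega> \<in> A")
        case True
        have "(\<Sum>n = n1..N. ennreal (1 / real n) * indicator (A - B n) \<omega>) \<le> (\<Sum>n = n1..N. ennreal (exp (log_stat n \<omega> - real n)))"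
        proof (intro sum_mono)
          fix n assume n: "n \<in> {n1..N}"
          show "ennreal (1 / real n) * indicator (A - B n) \<omega> \<le> ennreal (exp (log_stat n \<omega> - real n))"
          proof (cases "\<omega> \<in> B n")
            case False
            have "real n > 0" using n by (auto simp: n1_def)
            then have "1 / real n = exp (- ln (real n))" by (simp add: exp_minus divide_inverse)
            also have "\<dots> \<le> exp (log_stat n \<omega> - real n)" using False \<omega> by (simp add: B_def not_less)
            finally show ?thesis using True False by (simp add: ennreal_leI)
          qed simp
        qed
        also have "\<dots> = ennreal (\<Sum>n = n1..N. exp (log_stat n \<omega> - real n))" by (rule sum_ennreal) simp
        also have "\<dots> \<le> ennreal (\<Sum>n = 1..N. exp (log_stat n \<omega> - real n))"
          by (intro ennreal_leI sum_mono2) (auto simp: n1_def)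
        also have "\<dots> \<le> ennreal C" using True by (intro ennreal_leI) (auto simp: A_def)
        finally show ?thesis using True by simp
      qed simp
    qed
    also have "\<dots> = ennreal C * emeasure M A" by (rule nn_integral_cmult_indicator) measurable
    also have "\<dots> \<le> ennreal C * 1" by (intro mult_left_mono) (auto simp: measure_le_1 emeasure_le_1)
    finally have le: "ennreal (\<Sum>n = n1..N. prob A / 2 * (1 / real n)) \<le> ennreal C" by simp
    obtain \<omega> where "\<omega> \<in> A" using p by (metis equals0I measure_empty less_irrefl)
    then have "C \<ge> (\<Sum>n = 1..0. exp (log_stat n \<omega> - real n))" unfolding A_def by blast
    then have "C \<ge> 0" by simp
    then show ?thesis using le by simp
  qed
  then have "prob A / 2 * (\<Sum>n = n1..N. 1 / real n) \<le> C" for N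
    by (simp only: sum_distrib_left)
  then have bnd: "(\<Sum>n = n1..N. 1 / real n) \<le> 2 * C / prob A" for N
    using p by (simp add: pos_le_divide_eq mult_ac)
  have s: "summable (\<lambda>n. 1 / real n * (if n \<ge> n1 then 1 else 0))"
  proof (rule bounded_imp_summable)
    fix N
    have "(\<Sum>n\<le>N. 1 / real n * (if n1 \<le> n then 1 else 0)) = (\<Sum>n = n1..N. 1 / real n)"
      by (rule sum.mono_neutral_cong_right) auto
    then show "(\<Sum>n\<le>N. 1 / real n * (if n1 \<le> n then 1 else 0)) \<le> 2 * C / prob A" using bnd[of N] by simp
  qed auto
  have ev: "eventually (\<lambda>n. 1 / real n * (if n \<ge> n1 then 1 else 0) = 1 / real n) sequentially"
    using eventually_ge_at_top[of n1] by eventually_elim auto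
  from s have "summable (\<lambda>n. 1 / real n)" unfolding summable_cong[OF ev] .
  then show False using not_summable_harmonic[where 'a=real] by (simp add: inverse_eq_divide)
qed

lemma AE_log_stat_sum_unbounded:
  "AE \<omega> in M. \<not> (\<exists>C. \<forall>N. (\<Sum>n = 1..N. exp (log_stat n \<omega> - real n)) \<le> C)"
proof -
  note [measurable] = borel_measurable_log_stat
  have "AE \<omega> in M. \<not> (\<forall>N. (\<Sum>n = 1..N. exp (log_stat n \<omega> - real n)) \<le> real k)" for k :: nat
  proof (rule AE_I[where N = "{\<omega> \<in> space M. \<forall>N. (\<Sum>n = 1..N. exp (log_stat n \<omega> - real n)) \<le> real k}"])
    have "(\<lambda>\<omega>. \<Sum>n = 1..N. exp (log_stat n \<omega> - real n)) \<in> borel_measurable M" for N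
      by (intro borel_measurable_sum borel_measurable_exp borel_measurable_diff) auto
    then show "{\<omega> \<in> space M. \<forall>N. (\<Sum>n = 1..N. exp (log_stat n \<omega> - real n)) \<le> real k} \<in> sets M"
      by measurable
    show "emeasure M {\<omega> \<in> space M. \<forall>N. (\<Sum>n = 1..N. exp (log_stat n \<omega> - real n)) \<le> real k} = 0"
      using prob_log_stat_sum_bounded[of "real k"] by (simp add: emeasure_eq_measure)
  qed auto
  then have "AE \<omega> in M. \<forall>k::nat. \<not> (\<forall>N. (\<Sum>n = 1..N. exp (log_stat n \<omega> - real n)) \<le> real k)"
    by (simp add: AE_all_countable)
  then show ?thesis
  proof eventually_elim
    case (elim \<omega>)
    show ?case
    proof
      assume "\<exists>C. \<forall>N. (\<Sum>n = 1..N. exp (log_stat n \<omega> - real n)) \<le> C"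
      then obtain C where C: "\<And>N. (\<Sum>n = 1..N. exp (log_stat n \<omega> - real n)) \<le> C" by blast
      obtain k :: nat where "C \<le> real k" using real_arch_simple by blast
      with C elim show False by (meson order_trans)
    qed
  qed
qed

lemma AE_0_not_in: "AE \<omega> in M. 0 \<notin> \<Lambda> \<omega>"
proof -
  have meas: "(\<lambda>\<omega>. emeasure (count_space UNIV) (\<Lambda> \<omega> \<inter> {0})) \<in> borel_measurable M"
    by (rule measurable_count) simp
  have "emeasure plane_measure {0} = 0"
    by (simp add: plane_measure_def emeasure_density nn_integral_cmult_indicator)
  then have "(\<integral>\<^sup>+\<omega>. emeasure (count_space UNIV) (\<Lambda> \<omega> \<inter> {0}) \<partial>M) = 0"
    using first_intensity[of "{0}"] by simp
  then have "AE \<omega> in M. emeasure (count_space UNIV) (\<Lambda> \<omega> \<inter> {0}) = 0"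
    using nn_integral_0_iff_AE[OF meas] by blast
  then show ?thesis
    by eventually_elim (auto simp: emeasure_count_space_eq_0)
qed

lemma AE_uniqueness:
  "AE \<omega> in M. \<forall>f. f holomorphic_on UNIV \<longrightarrow> f \<in> L2_functions complex_gaussian \<longrightarrow>
    (\<forall>l\<in>\<Lambda> \<omega>. f l = 0) \<longrightarrow> f = (\<lambda>z. 0)"
  using AE_log_stat_sum_unbounded AE_0_not_in AE_space
proof eventually_elim
  case (elim \<omega>)
  show ?case
  proof (intro allI impI, rule ccontr)
    fix f :: "complex \<Rightarrow> complex"
    assume f: "f holomorphic_on UNIV" "f \<in> L2_functions complex_gaussian" "\<forall>l\<in>\<Lambda> \<omega>. f l = 0" "f \<noteq> (\<lambda>z. 0)"
    from f(4) obtain a where a: "f a \<noteq> 0" by auto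
    have "(\<integral>\<^sup>+z. ennreal ((cmod (f z))\<^sup>2) \<partial>complex_gaussian) < \<infinity>"
      using f(2) by (simp add: L2_functions_def integrable_iff_bounded)
    from log_statistic_sum_bounded[OF f(1) a this, of "\<Lambda> \<omega>"] f(3) elim finite_points_disc[OF elim(3)]
    show False by blast
  qed
qed

end

section \<open>Completeness of the exponentials\<close>

lemma cmod_add_square_le: "(cmod (a + b))\<^sup>2 \<le> 2 * (cmod a)\<^sup>2 + 2 * (cmod b)\<^sup>2"
  unfolding cmod_power2 using sum_squares_bound[of "Re a" "Re b"] sum_squares_bound[of "Im a" "Im b"]
  by (simp add: power2_sum)

lemma L2_functions_add:
  assumes "f \<in> L2_functions \<mu>" "g \<in> L2_functions \<mu>"
  shows "(\<lambda>x. f x + g x) \<in> L2_functions \<mu>"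
    and "(\<integral>x. (cmod (f x + g x))\<^sup>2 \<partial>\<mu>) \<le> 2 * (\<integral>x. (cmod (f x))\<^sup>2 \<partial>\<mu>) + 2 * (\<integral>x. (cmod (g x))\<^sup>2 \<partial>\<mu>)"
proof -
  have [measurable]: "f \<in> borel_measurable \<mu>" "g \<in> borel_measurable \<mu>"
    and int: "integrable \<mu> (\<lambda>x. (cmod (f x))\<^sup>2)" "integrable \<mu> (\<lambda>x. (cmod (g x))\<^sup>2)"
    using assms by (auto simp: L2_functions_def)
  let ?F = "\<lambda>x. 2 * (cmod (f x))\<^sup>2 + 2 * (cmod (g x))\<^sup>2"
  have F: "integrable \<mu> ?F" using int by auto
  have i: "integrable \<mu> (\<lambda>x. (cmod (f x + g x))\<^sup>2)"
    by (rule Bochner_Integration.integrable_bound[OF F]) (auto intro!: cmod_add_square_le)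
  then show "(\<lambda>x. f x + g x) \<in> L2_functions \<mu>" by (simp add: L2_functions_def)
  have "(\<integral>x. (cmod (f x + g x))\<^sup>2 \<partial>\<mu>) \<le> (\<integral>x. ?F x \<partial>\<mu>)"
    by (rule integral_mono[OF i F]) (rule cmod_add_square_le)
  then show "(\<integral>x. (cmod (f x + g x))\<^sup>2 \<partial>\<mu>) \<le> 2 * (\<integral>x. (cmod (f x))\<^sup>2 \<partial>\<mu>) + 2 * (\<integral>x. (cmod (g x))\<^sup>2 \<partial>\<mu>)"
    using int by simp
qed

lemma L2_functions_cmult: "f \<in> L2_functions \<mu> \<Longrightarrow> (\<lambda>x. c * f x) \<in> L2_functions \<mu>"
  by (auto simp: L2_functions_def norm_mult power_mult_distrib)

lemma L2_functions_diff:
  assumes "f \<in> L2_functions \<mu>" "g \<in> L2_functions \<mu>"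
  shows "(\<lambda>x. f x - g x) \<in> L2_functions \<mu>"
  using L2_functions_add(1)[OF assms(1) L2_functions_cmult[OF assms(2), of "-1"]] by simp

lemma L2_closure_iff:
  "f \<in> L2_closure \<mu> S \<longleftrightarrow> f \<in> L2_functions \<mu> \<and>
    (\<forall>\<epsilon>>0. \<exists>g\<in>S \<inter> L2_functions \<mu>. (\<integral>x. (cmod (f x - g x))\<^sup>2 \<partial>\<mu>) < \<epsilon>)"
proof -
  have "(\<forall>\<epsilon>>0. \<exists>g\<in>S \<inter> L2_functions \<mu>. L2_norm \<mu> (\<lambda>x. f x - g x) < \<epsilon>) \<longleftrightarrow>
    (\<forall>\<epsilon>>0. \<exists>g\<in>S \<inter> L2_functions \<mu>. (\<integral>x. (cmod (f x - g x))\<^sup>2 \<partial>\<mu>) < \<epsilon>)" (is "?L \<longleftrightarrow> ?R")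
  proof (intro iffI allI impI)
    fix \<epsilon> :: real assume "?L" "\<epsilon> > 0"
    then obtain g where "g \<in> S \<inter> L2_functions \<mu>" "L2_norm \<mu> (\<lambda>x. f x - g x) < sqrt \<epsilon>"
      by (metis real_sqrt_gt_zero)
    then show "\<exists>g\<in>S \<inter> L2_functions \<mu>. (\<integral>x. (cmod (f x - g x))\<^sup>2 \<partial>\<mu>) < \<epsilon>"
      by (intro bexI[of _ g]) (auto simp: L2_norm_def)
  next
    fix \<epsilon> :: real assume "?R" "\<epsilon> > 0"
    then obtain g where g: "g \<in> S \<inter> L2_functions \<mu>" "(\<integral>x. (cmod (f x - g x))\<^sup>2 \<partial>\<mu>) < \<epsilon>\<^sup>2"
      by (metis zero_less_power)
    have "L2_norm \<mu> (\<lambda>x. f x - g x) < \<epsilon>"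
      unfolding L2_norm_def using g(2) \<open>\<epsilon> > 0\<close> by (intro real_less_lsqrt) auto
    then show "\<exists>g\<in>S \<inter> L2_functions \<mu>. L2_norm \<mu> (\<lambda>x. f x - g x) < \<epsilon>" using g(1) by blast
  qed
  then show ?thesis unfolding L2_closure_def by simp
qed

lemma L2_closure_mono_closure:
  assumes "S \<subseteq> L2_closure \<mu> T"
  shows "L2_closure \<mu> S \<subseteq> L2_closure \<mu> T"
proof
  fix f assume f: "f \<in> L2_closure \<mu> S"
  show "f \<in> L2_closure \<mu> T"
    unfolding L2_closure_iff
  proof (intro conjI allI impI)
    show fL: "f \<in> L2_functions \<mu>" using f by (simp add: L2_closure_iff)
    fix \<epsilon> :: real assume "\<epsilon> > 0"
    then have e: "\<epsilon> / 4 > 0" by simp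
    from f e obtain g where g: "g \<in> S" "g \<in> L2_functions \<mu>" "(\<integral>x. (cmod (f x - g x))\<^sup>2 \<partial>\<mu>) < \<epsilon> / 4"
      unfolding L2_closure_iff by blast
    with assms e obtain h where h: "h \<in> T" "h \<in> L2_functions \<mu>" "(\<integral>x. (cmod (g x - h x))\<^sup>2 \<partial>\<mu>) < \<epsilon> / 4"
      unfolding L2_closure_iff subset_iff by blast
    have "(\<integral>x. (cmod ((f x - g x) + (g x - h x)))\<^sup>2 \<partial>\<mu>)
      \<le> 2 * (\<integral>x. (cmod (f x - g x))\<^sup>2 \<partial>\<mu>) + 2 * (\<integral>x. (cmod (g x - h x))\<^sup>2 \<partial>\<mu>)"
      by (intro L2_functions_add L2_functions_diff fL g h)
    also have "\<dots> < \<epsilon>" using g h by simp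
    finally show "\<exists>h\<in>T \<inter> L2_functions \<mu>. (\<integral>x. (cmod (f x - h x))\<^sup>2 \<partial>\<mu>) < \<epsilon>"
      using h by (intro bexI[of _ h]) auto
  qed
qed

interpretation complex_functions: vector_space "\<lambda>(c :: complex) (f :: complex \<Rightarrow> complex) z. c * f z"
  by (rule vector_space_complex_functions)

lemma subspace_L2_closure:
  assumes T: "complex_functions.subspace T"
  shows "complex_functions.subspace (L2_closure \<mu> T)"
proof (rule complex_functions.subspaceI)
  have "0 \<in> T" using T by (rule complex_functions.subspace_0)
  moreover have "0 \<in> L2_functions \<mu>" by (simp add: L2_functions_def zero_fun_def)
  ultimately show "0 \<in> L2_closure \<mu> T" unfolding L2_closure_iff
    by (auto intro!: bexI[of _ 0])
next
  fix f g assume fg: "f \<in> L2_closure \<mu> T" "g \<in> L2_closure \<mu> T"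
  show "f + g \<in> L2_closure \<mu> T"
    unfolding L2_closure_iff
  proof (intro conjI allI impI)
    have fgL: "f \<in> L2_functions \<mu>" "g \<in> L2_functions \<mu>" using fg by (auto simp: L2_closure_iff)
    then show "f + g \<in> L2_functions \<mu>" using L2_functions_add(1) by (simp add: plus_fun_def)
    fix \<epsilon> :: real assume "\<epsilon> > 0"
    then have e: "\<epsilon> / 4 > 0" by simp
    from fg e obtain f' g' where h: "f' \<in> T" "f' \<in> L2_functions \<mu>" "(\<integral>x. (cmod (f x - f' x))\<^sup>2 \<partial>\<mu>) < \<epsilon> / 4"
      "g' \<in> T" "g' \<in> L2_functions \<mu>" "(\<integral>x. (cmod (g x - g' x))\<^sup>2 \<partial>\<mu>) < \<epsilon> / 4"
      unfolding L2_closure_iff by blast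
    have "(\<integral>x. (cmod ((f x - f' x) + (g x - g' x)))\<^sup>2 \<partial>\<mu>)
      \<le> 2 * (\<integral>x. (cmod (f x - f' x))\<^sup>2 \<partial>\<mu>) + 2 * (\<integral>x. (cmod (g x - g' x))\<^sup>2 \<partial>\<mu>)"
      by (intro L2_functions_add L2_functions_diff fgL h)
    also have "\<dots> < \<epsilon>" using h by simp
    finally have "(\<integral>x. (cmod ((f + g) x - (f' + g') x))\<^sup>2 \<partial>\<mu>) < \<epsilon>" by (simp add: algebra_simps)
    moreover have "f' + g' \<in> T" using T h by (intro complex_functions.subspace_add)
    moreover have "f' + g' \<in> L2_functions \<mu>" using L2_functions_add(1) h by (simp add: plus_fun_def)
    ultimately show "\<exists>h\<in>T \<inter> L2_functions \<mu>. (\<integral>x. (cmod ((f + g) x - h x))\<^sup>2 \<partial>\<mu>) < \<epsilon>" by blast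
  qed
next
  fix c f assume f: "f \<in> L2_closure \<mu> T"
  show "(\<lambda>z. c * f z) \<in> L2_closure \<mu> T"
    unfolding L2_closure_iff
  proof (intro conjI allI impI)
    show "(\<lambda>z. c * f z) \<in> L2_functions \<mu>" using f by (simp add: L2_closure_iff L2_functions_cmult)
    fix \<epsilon> :: real assume "\<epsilon> > 0"
    moreover have c: "(cmod c)\<^sup>2 + 1 > 0" by (simp add: add_nonneg_pos)
    ultimately have "\<epsilon> / ((cmod c)\<^sup>2 + 1) > 0" by simp
    with f obtain g where g: "g \<in> T" "g \<in> L2_functions \<mu>" "(\<integral>x. (cmod (f x - g x))\<^sup>2 \<partial>\<mu>) < \<epsilon> / ((cmod c)\<^sup>2 + 1)"
      unfolding L2_closure_iff by blast
    have "(\<integral>x. (cmod (c * f x - c * g x))\<^sup>2 \<partial>\<mu>) = (\<integral>x. (cmod c)\<^sup>2 * (cmod (f x - g x))\<^sup>2 \<partial>\<mu>)"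
      by (simp only: right_diff_distrib[symmetric] norm_mult power_mult_distrib)
    also have "\<dots> = (cmod c)\<^sup>2 * (\<integral>x. (cmod (f x - g x))\<^sup>2 \<partial>\<mu>)" by simp
    also have "\<dots> \<le> ((cmod c)\<^sup>2 + 1) * (\<integral>x. (cmod (f x - g x))\<^sup>2 \<partial>\<mu>)"
      by (intro mult_right_mono) auto
    also have "\<dots> < \<epsilon>" using g(3) c by (simp add: pos_less_divide_eq mult.commute)
    finally have "(\<integral>x. (cmod (c * f x - c * g x))\<^sup>2 \<partial>\<mu>) < \<epsilon>" .
    moreover have "(\<lambda>z. c * g z) \<in> T \<inter> L2_functions \<mu>"
      using complex_functions.subspace_scale[OF T g(1)] L2_functions_cmult[OF g(2)] by simp
    ultimately show "\<exists>h\<in>T \<inter> L2_functions \<mu>. (\<integral>x. (cmod (c * f x - h x))\<^sup>2 \<partial>\<mu>) < \<epsilon>" by (rule bexI)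
  qed
qed

lemma integrable_gaussian_exp_norm: "integrable complex_gaussian (\<lambda>z. exp (c * cmod z))"
proof (rule integrableI_bounded)
  have le: "- (cmod z)\<^sup>2 + c * cmod z \<le> c\<^sup>2 / 2 + - (1 / 2) * (cmod z)\<^sup>2" for z
    using sum_squares_bound[of c "cmod z"] by simp
  have "(\<integral>\<^sup>+z. ennreal (norm (exp (c * cmod z))) \<partial>complex_gaussian)
      = (\<integral>\<^sup>+z. ennreal (exp (- (cmod z)\<^sup>2 + c * cmod z)) \<partial>plane_measure)"
    unfolding exp_add by (subst nn_integral_complex_gaussian) (auto simp: ennreal_mult)
  also have "\<dots> \<le> (\<integral>\<^sup>+z. ennreal (exp (c\<^sup>2 / 2 + - (1 / 2) * (cmod z)\<^sup>2)) \<partial>plane_measure)"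
    using le by (intro nn_integral_mono ennreal_leI) simp
  also have "\<dots> = ennreal (exp (c\<^sup>2 / 2)) * (\<integral>\<^sup>+z. ennreal (exp (- (1 / 2) * (cmod z)\<^sup>2)) \<partial>plane_measure)"
    unfolding exp_add by (subst nn_integral_cmult[symmetric]) (auto simp: ennreal_mult)
  also have "\<dots> < \<infinity>"
    by (subst nn_integral_plane_gaussian) (auto simp: ennreal_mult_less_top)
  finally show "(\<integral>\<^sup>+z. ennreal (norm (exp (c * cmod z))) \<partial>complex_gaussian) < \<infinity>" .
qed simp

lemma L2_functions_exp_bound:
  assumes [measurable]: "f \<in> borel_measurable borel" and le: "\<And>z. cmod (f z) \<le> C * exp (c * cmod z)"
  shows "f \<in> L2_functions complex_gaussian"
proof -
  have "integrable complex_gaussian (\<lambda>z. C\<^sup>2 * exp ((2 * c) * cmod z))"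
    using integrable_gaussian_exp_norm[of "2 * c"] by simp
  then have "integrable complex_gaussian (\<lambda>z. (cmod (f z))\<^sup>2)"
  proof (rule Bochner_Integration.integrable_bound)
    have "(cmod (f z))\<^sup>2 \<le> (C * exp (c * cmod z))\<^sup>2" for z
      by (intro power_mono le) auto
    then show "AE z in complex_gaussian. norm ((cmod (f z))\<^sup>2) \<le> norm (C\<^sup>2 * exp ((2 * c) * cmod z))"
      by (auto simp: power_mult_distrib exp_double[symmetric] mult.assoc)
  qed measurable
  then show ?thesis by (simp add: L2_functions_def)
qed

lemma poly_exp_bound:
  fixes p :: "complex poly"
  shows "\<exists>C\<ge>0. \<exists>c. \<forall>z. cmod (poly p z) \<le> C * exp (c * cmod z)"
proof (induction p)
  case 0
  then show ?case by (intro exI[of _ 0]) auto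
next
  case (pCons a p)
  then obtain C c where C: "C \<ge> 0" "\<And>z. cmod (poly p z) \<le> C * exp (c * cmod z)" by blast
  have "cmod (poly (pCons a p) z) \<le> (cmod a + C) * exp ((\<bar>c\<bar> + 1) * cmod z)" for z
  proof -
    have "cmod (poly (pCons a p) z) \<le> cmod a + cmod z * cmod (poly p z)"
      by (simp add: norm_mult[symmetric] norm_triangle_ineq)
    also have "\<dots> \<le> cmod a * exp ((\<bar>c\<bar> + 1) * cmod z) + exp (cmod z) * (C * exp (\<bar>c\<bar> * cmod z))"
    proof (intro add_mono mult_mono)
      show "cmod a \<le> cmod a * exp ((\<bar>c\<bar> + 1) * cmod z)"
        using mult_left_mono[of 1 "exp ((\<bar>c\<bar> + 1) * cmod z)" "cmod a"] by simp
      show "cmod z \<le> exp (cmod z)" using exp_ge_add_one_self[of "cmod z"] by linarith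
      have "C * exp (c * cmod z) \<le> C * exp (\<bar>c\<bar> * cmod z)"
        using C(1) by (intro mult_left_mono) (auto intro!: mult_right_mono)
      then show "cmod (poly p z) \<le> C * exp (\<bar>c\<bar> * cmod z)" using C(2)[of z] by linarith
    qed auto
    also have "\<dots> = (cmod a + C) * exp ((\<bar>c\<bar> + 1) * cmod z)"
      by (simp add: algebra_simps exp_add)
    finally show ?thesis .
  qed
  then show ?case using C(1) by (intro exI[of _ "cmod a + C"]) auto
qed

lemma poly_L2: "poly p \<in> L2_functions complex_gaussian"
proof -
  obtain C c where "\<And>z. cmod (poly p z) \<le> C * exp (c * cmod z)" using poly_exp_bound[of p] by blast
  then show ?thesis
    by (intro L2_functions_exp_bound borel_measurable_continuous_onI continuous_on_poly continuous_on_id)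
qed

lemma norm_exp_mult_le: "cmod (exp (a * z)) \<le> exp (cmod a * cmod z)"
  using norm_exp[of "a * z"] by (simp only: norm_mult)

lemma exponential_L2: "(\<lambda>z. exp (a * z)) \<in> L2_functions complex_gaussian"
  by (rule L2_functions_exp_bound[of _ 1 "cmod a"]) (measurable, simp only: mult_1 norm_exp_mult_le)

lemma exponential_in_closure_poly: "(\<lambda>z. exp (a * z)) \<in> L2_closure complex_gaussian (range poly)"
proof -
  define t where "t n = (\<Sum>k<n. monom (a ^ k / fact k) k)" for n
  have t: "poly (t n) z = (\<Sum>k<n. (a * z) ^ k /\<^sub>R fact k)" for n z
    by (simp add: t_def poly_sum poly_monom power_mult_distrib scaleR_conv_of_real field_simps)
  have lim: "(\<lambda>n. poly (t n) z) \<longlonglongrightarrow> exp (a * z)" for z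
    unfolding t using exp_converges[of "a * z"] by (simp add: sums_def)
  have bnd: "cmod (poly (t n) z) \<le> exp (cmod a * cmod z)" for n z
  proof -
    have "cmod (poly (t n) z) \<le> (\<Sum>k<n. (cmod a * cmod z) ^ k /\<^sub>R fact k)"
      unfolding t by (rule sum_norm_le) (simp add: norm_power norm_mult)
    also have "\<dots> \<le> exp (cmod a * cmod z)"
      using exp_converges[of "cmod a * cmod z"]
      by (subst sums_unique[of _ "exp (cmod a * cmod z)"]) (auto intro!: sum_le_suminf simp: sums_iff)
    finally show ?thesis .
  qed
  let ?d = "\<lambda>n z. (cmod (exp (a * z) - poly (t n) z))\<^sup>2"
  have [measurable]: "poly p \<in> borel_measurable borel" for p :: "complex poly"
    by (intro borel_measurable_continuous_onI continuous_on_poly continuous_on_id)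
  have "(\<lambda>n. \<integral>z. ?d n z \<partial>complex_gaussian) \<longlonglongrightarrow> (\<integral>z. 0 \<partial>complex_gaussian)"
  proof (rule integral_dominated_convergence[where w = "\<lambda>z. 4 * exp ((2 * cmod a) * cmod z)"])
    show "integrable complex_gaussian (\<lambda>z. 4 * exp ((2 * cmod a) * cmod z))"
      using integrable_gaussian_exp_norm[of "2 * cmod a"] by simp
    show "AE z in complex_gaussian. (\<lambda>n. ?d n z) \<longlonglongrightarrow> 0"
    proof (rule AE_I2)
      fix z
      have "(\<lambda>n. (cmod (exp (a * z) - poly (t n) z))\<^sup>2) \<longlonglongrightarrow> (cmod (exp (a * z) - exp (a * z)))\<^sup>2"
        by (intro tendsto_intros lim)
      then show "(\<lambda>n. ?d n z) \<longlonglongrightarrow> 0" by simp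
    qed
    show "AE z in complex_gaussian. norm (?d n z) \<le> 4 * exp ((2 * cmod a) * cmod z)" for n
    proof (rule AE_I2)
      fix z
      have "cmod (exp (a * z) - poly (t n) z) \<le> 2 * exp (cmod a * cmod z)"
        using norm_triangle_ineq4[of "exp (a * z)" "poly (t n) z"] bnd[of n z] norm_exp_mult_le[of a z] by linarith
      then have "?d n z \<le> (2 * exp (cmod a * cmod z))\<^sup>2" by (intro power_mono) auto
      then show "norm (?d n z) \<le> 4 * exp ((2 * cmod a) * cmod z)"
        by (simp add: power_mult_distrib exp_double[symmetric] mult.assoc)
    qed
  qed measurable
  then have conv: "(\<lambda>n. \<integral>z. ?d n z \<partial>complex_gaussian) \<longlonglongrightarrow> 0" by simp
  show ?thesis
    unfolding L2_closure_iff
  proof (intro conjI allI impI exponential_L2)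
    fix \<epsilon> :: real assume "\<epsilon> > 0"
    from order_tendstoD(2)[OF conv this] obtain n where "(\<integral>z. ?d n z \<partial>complex_gaussian) < \<epsilon>"
      by (auto simp: eventually_sequentially)
    then show "\<exists>g\<in>range poly \<inter> L2_functions complex_gaussian. (\<integral>z. (cmod (exp (a * z) - g z))\<^sup>2 \<partial>complex_gaussian) < \<epsilon>"
      using poly_L2 by (intro bexI[of _ "poly (t n)"]) auto
  qed
qed

lemma subspace_range_poly: "complex_functions.subspace (range poly)"
proof (rule complex_functions.subspaceI)
  show "0 \<in> range (poly :: complex poly \<Rightarrow> _)" by (rule range_eqI[of _ _ 0]) auto
next
  fix f g :: "complex \<Rightarrow> complex" assume "f \<in> range poly" "g \<in> range poly"
  then obtain p q where "f = poly p" "g = poly q" by auto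
  then show "f + g \<in> range poly" by (intro range_eqI[of _ _ "p + q"]) auto
next
  fix c and f :: "complex \<Rightarrow> complex" assume "f \<in> range poly"
  then obtain p where "f = poly p" by auto
  then show "(\<lambda>z. c * f z) \<in> range poly" by (intro range_eqI[of _ _ "Polynomial.smult c p"]) auto
qed

lemma span_exponentials_subset_closure_poly:
  "complex_functions.span (exponentials A) \<subseteq> L2_closure complex_gaussian (range poly)"
proof (rule complex_functions.span_minimal)
  show "exponentials A \<subseteq> L2_closure complex_gaussian (range poly)"
    using exponential_in_closure_poly by (auto simp: exponentials_def)
qed (rule subspace_L2_closure[OF subspace_range_poly])

lemma subspace_entire_L2:
  "complex_functions.subspace {f. f holomorphic_on UNIV \<and> f \<in> L2_functions complex_gaussian}"
proof (rule complex_functions.subspaceI)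
  show "0 \<in> {f. f holomorphic_on UNIV \<and> f \<in> L2_functions complex_gaussian}"
    by (simp add: L2_functions_def zero_fun_def)
qed (auto simp: plus_fun_def L2_functions_cmult L2_functions_add intro!: holomorphic_intros)

lemma span_exponentials_entire_L2:
  assumes "f \<in> complex_functions.span (exponentials A)"
  shows "f holomorphic_on UNIV" "f \<in> L2_functions complex_gaussian"
proof -
  have "complex_functions.span (exponentials A) \<subseteq> {f. f holomorphic_on UNIV \<and> f \<in> L2_functions complex_gaussian}"
    by (rule complex_functions.span_minimal[OF _ subspace_entire_L2])
       (auto simp: exponentials_def intro!: exponential_L2 holomorphic_intros)
  then show "f holomorphic_on UNIV" "f \<in> L2_functions complex_gaussian" using assms by auto
qed

lemma L2_gaussian_integrable:
  assumes "f \<in> L2_functions complex_gaussian"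
  shows "integrable complex_gaussian f"
proof -
  have [measurable]: "f \<in> borel_measurable complex_gaussian"
    and int: "integrable complex_gaussian (\<lambda>z. (cmod (f z))\<^sup>2)"
    using assms by (auto simp: L2_functions_def)
  have "integrable complex_gaussian (\<lambda>z. cmod (f z))"
    by (rule gaussian.square_integrable_imp_integrable[OF _ int]) measurable
  then show ?thesis by (subst (asm) integrable_norm_iff) measurable
qed

lemma integral_gaussian_diff_value_at_0:
  assumes g: "g holomorphic_on UNIV" and L2: "g \<in> L2_functions complex_gaussian"
  shows "(\<integral>z. (cmod (g z - g 0))\<^sup>2 \<partial>complex_gaussian) = (\<integral>z. (cmod (g z))\<^sup>2 \<partial>complex_gaussian) - (cmod (g 0))\<^sup>2"
proof -
  have int: "integrable complex_gaussian g" using L2 by (rule L2_gaussian_integrable)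
  have int2: "integrable complex_gaussian (\<lambda>z. (cmod (g z))\<^sup>2)" using L2 by (simp add: L2_functions_def)
  have e: "(cmod (g z - g 0))\<^sup>2 = (cmod (g z))\<^sup>2 + (cmod (g 0))\<^sup>2 - 2 * Re (cnj (g 0) * g z)" for z
    unfolding cmod_power2 by (simp add: power2_eq_square algebra_simps)
  have "(\<integral>z. Re (cnj (g 0) * g z) \<partial>complex_gaussian) = Re (cnj (g 0) * g 0)"
    using int integral_gaussian_entire[OF g int] by simp
  also have "\<dots> = (cmod (g 0))\<^sup>2" unfolding cmod_power2 by (simp add: power2_eq_square)
  finally have "(\<integral>z. Re (cnj (g 0) * g z) \<partial>complex_gaussian) = (cmod (g 0))\<^sup>2" .
  then show ?thesis
    unfolding e using int int2 gaussian.prob_space by simp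
qed

definition fock_translate :: "complex \<Rightarrow> (complex \<Rightarrow> complex) \<Rightarrow> complex \<Rightarrow> complex" where
  "fock_translate l f z = f (l + z) * exp (- cnj l * z)"

lemma nn_integral_fock_translate:
  assumes [measurable]: "f \<in> borel_measurable borel"
  shows "(\<integral>\<^sup>+z. ennreal ((cmod (fock_translate l f z))\<^sup>2) \<partial>complex_gaussian)
    = ennreal (exp ((cmod l)\<^sup>2)) * (\<integral>\<^sup>+z. ennreal ((cmod (f z))\<^sup>2) \<partial>complex_gaussian)"
proof -
  let ?F = "\<lambda>w. ennreal (exp (- (cmod w)\<^sup>2)) * ennreal ((cmod (f w))\<^sup>2)"
  have e: "ennreal (exp (- (cmod z)\<^sup>2)) * ennreal ((cmod (fock_translate l f z))\<^sup>2) = ennreal (exp ((cmod l)\<^sup>2)) * ?F (l + z)" for z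
  proof -
    have "exp (- (cmod z)\<^sup>2) * (cmod (exp (- cnj l * z)))\<^sup>2 = exp (- (cmod z)\<^sup>2 + 2 * Re (- cnj l * z))"
      by (simp only: exp_add exp_double norm_exp_eq_Re)
    also have "- (cmod z)\<^sup>2 + 2 * Re (- cnj l * z) = (cmod l)\<^sup>2 + - (cmod (l + z))\<^sup>2"
      unfolding cmod_power2 by (simp add: power2_eq_square algebra_simps)
    also have "exp \<dots> = exp ((cmod l)\<^sup>2) * exp (- (cmod (l + z))\<^sup>2)" by (rule exp_add)
    finally have "exp (- (cmod z)\<^sup>2) * (cmod (fock_translate l f z))\<^sup>2
        = exp ((cmod l)\<^sup>2) * (exp (- (cmod (l + z))\<^sup>2) * (cmod (f (l + z)))\<^sup>2)"
      unfolding fock_translate_def norm_mult power_mult_distrib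
      by (drule_tac arg_cong[where f = "\<lambda>x. x * (cmod (f (l + z)))\<^sup>2"]) (simp only: mult_ac)
    then have "ennreal (exp (- (cmod z)\<^sup>2) * (cmod (fock_translate l f z))\<^sup>2)
        = ennreal (exp ((cmod l)\<^sup>2) * (exp (- (cmod (l + z))\<^sup>2) * (cmod (f (l + z)))\<^sup>2))"
      by (rule arg_cong)
    then show ?thesis by (simp only: ennreal_mult'[OF exp_ge_zero])
  qed
  have [measurable]: "fock_translate l f \<in> borel_measurable borel"
    unfolding fock_translate_def[abs_def] by measurable
  have "(\<integral>\<^sup>+z. ennreal ((cmod (fock_translate l f z))\<^sup>2) \<partial>complex_gaussian)
      = (\<integral>\<^sup>+z. ennreal (exp ((cmod l)\<^sup>2)) * ?F (l + z) \<partial>plane_measure)"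
    by (subst nn_integral_complex_gaussian) (auto simp: e)
  also have "\<dots> = ennreal (exp ((cmod l)\<^sup>2)) * (\<integral>\<^sup>+z. ?F (l + z) \<partial>plane_measure)"
    by (rule nn_integral_cmult) measurable
  also have "(\<integral>\<^sup>+z. ?F (l + z) \<partial>plane_measure) = (\<integral>\<^sup>+z. ?F z \<partial>plane_measure)"
    by (rule nn_integral_plane_translate) measurable
  finally show ?thesis by (subst nn_integral_complex_gaussian) auto
qed

lemma fock_translate_L2:
  assumes f: "f \<in> L2_functions complex_gaussian" 
  shows "fock_translate l f \<in> L2_functions complex_gaussian"
    and "(\<integral>z. (cmod (fock_translate l f z))\<^sup>2 \<partial>complex_gaussian)
      = exp ((cmod l)\<^sup>2) * (\<integral>z. (cmod (f z))\<^sup>2 \<partial>complex_gaussian)"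
proof -
  have [measurable]: "f \<in> borel_measurable borel" using f by (simp add: L2_functions_def cong: measurable_cong_sets)
  have fin: "(\<integral>\<^sup>+z. ennreal ((cmod (f z))\<^sup>2) \<partial>complex_gaussian) < \<infinity>"
    using f by (simp add: L2_functions_def integrable_iff_bounded)
  have meas [measurable]: "fock_translate l f \<in> borel_measurable borel"
    unfolding fock_translate_def[abs_def] by measurable
  have "integrable complex_gaussian (\<lambda>z. (cmod (fock_translate l f z))\<^sup>2)"
    using fin by (intro integrableI_bounded) (auto simp: nn_integral_fock_translate ennreal_mult_less_top)
  then show "fock_translate l f \<in> L2_functions complex_gaussian"
    by (simp add: L2_functions_def)
  show "(\<integral>z. (cmod (fock_translate l f z))\<^sup>2 \<partial>complex_gaussian)
      = exp ((cmod l)\<^sup>2) * (\<integral>z. (cmod (f z))\<^sup>2 \<partial>complex_gaussian)"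
    by (simp add: integral_eq_nn_integral nn_integral_fock_translate enn2real_mult)
qed

text \<open>The norm of the projection of \<open>h\<close> onto the orthogonal complement of \<open>e\<^sub>l\<close>; \<open>fock_translate l\<close>,
  a multiple of a unitary map, reduces it to \<open>l = 0\<close>, where it is the mean value property.\<close>

lemma integral_remove_kernel:
  assumes h: "h holomorphic_on UNIV" and L2: "h \<in> L2_functions complex_gaussian"
  shows "(\<integral>z. (cmod (h z - h l * exp (- of_real ((cmod l)\<^sup>2)) * exp (cnj l * z)))\<^sup>2 \<partial>complex_gaussian)
    = (\<integral>z. (cmod (h z))\<^sup>2 \<partial>complex_gaussian) - exp (- (cmod l)\<^sup>2) * (cmod (h l))\<^sup>2"
proof -
  let ?c = "h l * exp (- of_real ((cmod l)\<^sup>2))"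
  let ?k = "\<lambda>z. h z - ?c * exp (cnj l * z)"
  have kL: "?k \<in> L2_functions complex_gaussian"
    by (intro L2_functions_diff L2 L2_functions_cmult exponential_L2)
  have hT: "fock_translate l h holomorphic_on UNIV"
    unfolding fock_translate_def[abs_def]
    by (intro holomorphic_intros holomorphic_on_compose_gen[OF _ h, unfolded o_def]) auto
  have h0: "fock_translate l h 0 = h l" by (simp add: fock_translate_def)
  have kT: "fock_translate l ?k z = fock_translate l h z - fock_translate l h 0" for z
  proof -
    have "exp (- of_real ((cmod l)\<^sup>2)) * exp (cnj l * (l + z)) * exp (- cnj l * z) = 1"
      unfolding exp_add[symmetric] complex_norm_square by (simp add: algebra_simps)
    then have "?c * exp (cnj l * (l + z)) * exp (- cnj l * z) = h l"
      by (simp only: mult.assoc mult_1_right)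
    then show ?thesis unfolding h0 by (simp add: fock_translate_def left_diff_distrib)
  qed
  have "exp ((cmod l)\<^sup>2) * (\<integral>z. (cmod (?k z))\<^sup>2 \<partial>complex_gaussian)
      = (\<integral>z. (cmod (fock_translate l ?k z))\<^sup>2 \<partial>complex_gaussian)"
    by (rule fock_translate_L2(2)[OF kL, symmetric])
  also have "\<dots> = (\<integral>z. (cmod (fock_translate l h z - fock_translate l h 0))\<^sup>2 \<partial>complex_gaussian)"
    by (simp only: kT)
  also have "\<dots> = (\<integral>z. (cmod (fock_translate l h z))\<^sup>2 \<partial>complex_gaussian) - (cmod (h l))\<^sup>2"
    using integral_gaussian_diff_value_at_0[OF hT fock_translate_L2(1)[OF L2]] by (simp only: h0)
  also have "\<dots> = exp ((cmod l)\<^sup>2) * (\<integral>z. (cmod (h z))\<^sup>2 \<partial>complex_gaussian) - (cmod (h l))\<^sup>2"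
    unfolding fock_translate_L2(2)[OF L2] ..
  finally show ?thesis by (simp add: exp_minus field_simps)
qed

lemma fock_pointwise_bound:
  assumes h: "h holomorphic_on UNIV" and L2: "h \<in> L2_functions complex_gaussian"
  shows "(cmod (h l))\<^sup>2 \<le> exp ((cmod l)\<^sup>2) * (\<integral>z. (cmod (h z))\<^sup>2 \<partial>complex_gaussian)"
proof -
  have "0 \<le> (\<integral>z. (cmod (h z))\<^sup>2 \<partial>complex_gaussian) - exp (- (cmod l)\<^sup>2) * (cmod (h l))\<^sup>2"
    unfolding integral_remove_kernel[OF assms, symmetric] by simp
  then show ?thesis by (simp add: exp_minus field_simps)
qed

lemma integral_parallelogram:
  assumes f: "f \<in> L2_functions \<mu>" and g: "g \<in> L2_functions \<mu>"
  shows "(\<integral>x. (cmod (f x - g x))\<^sup>2 \<partial>\<mu>) =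
    2 * (\<integral>x. (cmod (f x))\<^sup>2 \<partial>\<mu>) + 2 * (\<integral>x. (cmod (g x))\<^sup>2 \<partial>\<mu>) - 4 * (\<integral>x. (cmod ((f x + g x) / 2))\<^sup>2 \<partial>\<mu>)"
proof -
  have e: "(cmod (a - b))\<^sup>2 = 2 * (cmod a)\<^sup>2 + 2 * (cmod b)\<^sup>2 - 4 * (cmod ((a + b) / 2))\<^sup>2" for a b :: complex
    unfolding cmod_power2 by (simp add: power2_eq_square field_simps)
  have "(\<lambda>x. (f x + g x) / 2) \<in> L2_functions \<mu>"
    using L2_functions_cmult[OF L2_functions_add(1)[OF f g], of "1/2"] by simp
  then show ?thesis
    using f g unfolding e by (simp add: L2_functions_def)
qed

lemma entire_L2_Cauchy_limit:
  assumes h: "\<And>k. h k holomorphic_on UNIV" "\<And>k. h k \<in> L2_functions complex_gaussian"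
    and Cauchy: "\<And>j k. (\<integral>z. (cmod (h j z - h k z))\<^sup>2 \<partial>complex_gaussian) \<le> e j + e k"
    and e: "e \<longlonglongrightarrow> 0"
  obtains f where "f holomorphic_on UNIV" "f \<in> L2_functions complex_gaussian"
    "\<And>z. (\<lambda>k. h k z) \<longlonglongrightarrow> f z"
    "\<And>j. (\<integral>z. (cmod (h j z - f z))\<^sup>2 \<partial>complex_gaussian) \<le> e j"
proof -
  have [measurable]: "h k \<in> borel_measurable borel" for k by (rule borel_measurable_entire[OF h(1)])
  have pt: "(cmod (h j z - h k z))\<^sup>2 \<le> exp ((cmod z)\<^sup>2) * (e j + e k)" for j k z
  proof -
    have "(cmod (h j z - h k z))\<^sup>2 \<le> exp ((cmod z)\<^sup>2) * (\<integral>w. (cmod (h j w - h k w))\<^sup>2 \<partial>complex_gaussian)"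
      by (rule fock_pointwise_bound) (intro holomorphic_intros h L2_functions_diff)+
    also have "\<dots> \<le> exp ((cmod z)\<^sup>2) * (e j + e k)"
      by (intro mult_left_mono Cauchy) auto
    finally show ?thesis .
  qed
  have "Cauchy (\<lambda>k. h k z)" for z
  proof (rule metric_CauchyI)
    fix \<epsilon> :: real assume "\<epsilon> > 0"
    then have "\<epsilon>\<^sup>2 / exp ((cmod z)\<^sup>2) / 2 > 0" by simp
    from order_tendstoD(2)[OF e this] obtain K where K: "\<And>k. k \<ge> K \<Longrightarrow> e k < \<epsilon>\<^sup>2 / exp ((cmod z)\<^sup>2) / 2"
      by (auto simp: eventually_sequentially)
    show "\<exists>K. \<forall>j\<ge>K. \<forall>k\<ge>K. dist (h j z) (h k z) < \<epsilon>"
    proof (intro exI allI impI)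
      fix j k assume "j \<ge> K" "k \<ge> K"
      then have "e j + e k < \<epsilon>\<^sup>2 / exp ((cmod z)\<^sup>2)" using K[of j] K[of k] by linarith
      then have "exp ((cmod z)\<^sup>2) * (e j + e k) < \<epsilon>\<^sup>2" by (simp add: pos_less_divide_eq mult.commute)
      then have "(cmod (h j z - h k z))\<^sup>2 < \<epsilon>\<^sup>2" using pt[of j z k] by linarith
      then show "dist (h j z) (h k z) < \<epsilon>"
        using \<open>\<epsilon> > 0\<close> by (simp add: dist_norm power_less_imp_less_base)
    qed
  qed
  then have "\<exists>w. (\<lambda>k. h k z) \<longlonglongrightarrow> w" for z
    using Cauchy_convergent convergent_def by blast
  then obtain f where lim: "\<And>z. (\<lambda>k. h k z) \<longlonglongrightarrow> f z" by metis
  have ptf: "(cmod (h j z - f z))\<^sup>2 \<le> exp ((cmod z)\<^sup>2) * e j" for j z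
  proof (rule LIMSEQ_le)
    show "(\<lambda>k. (cmod (h j z - h k z))\<^sup>2) \<longlonglongrightarrow> (cmod (h j z - f z))\<^sup>2"
      by (intro tendsto_intros lim)
    have "(\<lambda>k. exp ((cmod z)\<^sup>2) * (e j + e k)) \<longlonglongrightarrow> exp ((cmod z)\<^sup>2) * (e j + 0)"
      by (intro tendsto_intros e)
    then show "(\<lambda>k. exp ((cmod z)\<^sup>2) * (e j + e k)) \<longlonglongrightarrow> exp ((cmod z)\<^sup>2) * e j" by simp
  qed (use pt in auto)
  have hol: "f holomorphic_on UNIV"
  proof (rule holomorphic_uniform_sequence[OF open_UNIV h(1)])
    fix x :: complex
    have "uniform_limit (cball x 1) h f sequentially"
    proof (rule uniform_limitI)
      fix \<epsilon> :: real assume "\<epsilon> > 0"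
      define B where "B = exp ((cmod x + 1)\<^sup>2)"
      have "\<epsilon>\<^sup>2 / B > 0" using \<open>\<epsilon> > 0\<close> by (simp add: B_def)
      from order_tendstoD(2)[OF e this] show "\<forall>\<^sub>F n in sequentially. \<forall>z\<in>cball x 1. dist (h n z) (f z) < \<epsilon>"
      proof eventually_elim
        case (elim n)
        show ?case
        proof
          fix z assume "z \<in> cball x 1"
          then have "cmod z \<le> cmod x + 1" using norm_triangle_ineq2[of z x] by (simp add: dist_norm norm_minus_commute)
          then have le: "exp ((cmod z)\<^sup>2) \<le> B" by (simp add: B_def power_mono)
          have e0: "e n \<ge> 0" using Cauchy[of n n] by simp
          have "(cmod (h n z - f z))\<^sup>2 \<le> B * e n"
            using ptf[of n z] mult_right_mono[OF le e0] by linarith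
          also have "\<dots> < \<epsilon>\<^sup>2" using elim by (simp add: B_def pos_less_divide_eq mult.commute)
          finally show "dist (h n z) (f z) < \<epsilon>"
            using \<open>\<epsilon> > 0\<close> by (simp add: dist_norm power_less_imp_less_base)
        qed
      qed
    qed
    then show "\<exists>d>0. cball x d \<subseteq> UNIV \<and> uniform_limit (cball x d) h f sequentially"
      by (intro exI[of _ 1]) auto
  qed
  then have [measurable]: "f \<in> borel_measurable borel" by (rule borel_measurable_entire)
  have fatou: "(\<integral>\<^sup>+z. ennreal ((cmod (h j z - f z))\<^sup>2) \<partial>complex_gaussian) \<le> ennreal (e j)" for j
  proof -
    have diff: "integrable complex_gaussian (\<lambda>z. (cmod (h j z - h k z))\<^sup>2)" for k
      using L2_functions_diff[OF h(2)[of j] h(2)[of k]] by (simp add: L2_functions_def)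
    have "(\<integral>\<^sup>+z. ennreal ((cmod (h j z - f z))\<^sup>2) \<partial>complex_gaussian)
        = (\<integral>\<^sup>+z. liminf (\<lambda>k. ennreal ((cmod (h j z - h k z))\<^sup>2)) \<partial>complex_gaussian)"
      by (intro nn_integral_cong lim_imp_Liminf[symmetric] tendsto_intros lim) auto
    also have "\<dots> \<le> liminf (\<lambda>k. \<integral>\<^sup>+z. ennreal ((cmod (h j z - h k z))\<^sup>2) \<partial>complex_gaussian)"
      by (rule nn_integral_liminf) measurable
    also have "\<dots> \<le> liminf (\<lambda>k. ennreal (e j + e k))"
      using Cauchy by (intro Liminf_mono always_eventually allI)
        (subst nn_integral_eq_integral[OF diff], auto intro: ennreal_leI)
    also have "\<dots> = ennreal (e j)"
    proof (rule lim_imp_Liminf)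
      have "(\<lambda>k. ennreal (e j + e k)) \<longlonglongrightarrow> ennreal (e j + 0)"
        by (intro tendsto_intros e)
      then show "(\<lambda>k. ennreal (e j + e k)) \<longlonglongrightarrow> ennreal (e j)" by simp
    qed simp
    finally show ?thesis .
  qed
  have fin: "(\<integral>\<^sup>+z. ennreal ((cmod (h j z - f z))\<^sup>2) \<partial>complex_gaussian) < \<infinity>" for j
    using fatou[of j] by (rule le_less_trans) simp
  have hf: "(\<lambda>z. h j z - f z) \<in> L2_functions complex_gaussian" for j
    using fin[of j] by (auto simp: L2_functions_def intro!: integrableI_bounded)
  have "f \<in> L2_functions complex_gaussian"
    using L2_functions_diff[OF h(2)[of 0] hf[of 0]] by simp
  moreover have "(\<integral>z. (cmod (h j z - f z))\<^sup>2 \<partial>complex_gaussian) \<le> e j" for j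
  proof -
    have "0 \<le> e j" using Cauchy[of j j] by simp
    then show ?thesis
      using fatou[of j] by (subst integral_eq_nn_integral) (auto intro!: enn2real_leI)
  qed
  ultimately show ?thesis using that hol lim by blast
qed

text \<open>The residuals of a minimizing sequence in the span form a Cauchy sequence. By
  \<open>integral_remove_kernel\<close> their values on \<open>A\<close> tend to zero, so their limit vanishes on \<open>A\<close>,
  hence vanishes identically.\<close>

lemma poly_in_closure_span_exponentials:
  assumes uniq: "\<And>f. f holomorphic_on UNIV \<Longrightarrow> f \<in> L2_functions complex_gaussian \<Longrightarrow> (\<And>l. l \<in> A \<Longrightarrow> f l = 0) \<Longrightarrow> f = (\<lambda>z. 0)"
  shows "poly p \<in> L2_closure complex_gaussian (complex_functions.span (exponentials A))"
proof -
  let ?V = "complex_functions.span (exponentials A)"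
  let ?N = "\<lambda>f. \<integral>z. (cmod (f z))\<^sup>2 \<partial>complex_gaussian"
  define d where "d = (INF v\<in>?V. ?N (\<lambda>z. poly p z - v z))"
  have bdd: "bdd_below ((\<lambda>v. ?N (\<lambda>z. poly p z - v z)) ` ?V)"
    by (rule bdd_belowI[of _ 0]) auto
  have d_le: "d \<le> ?N (\<lambda>z. poly p z - v z)" if "v \<in> ?V" for v
    unfolding d_def by (rule cINF_lower[OF bdd that])
  have "\<exists>v\<in>?V. ?N (\<lambda>z. poly p z - v z) < d + 1 / real (Suc k)" for k
  proof -
    have "(INF v\<in>?V. ?N (\<lambda>z. poly p z - v z)) < d + 1 / real (Suc k)" unfolding d_def[symmetric] by simp
    moreover have "?V \<noteq> {}" using complex_functions.span_zero by blast
    ultimately show ?thesis using bdd by (simp add: cINF_less_iff)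
  qed
  then obtain g where g: "\<And>k. g k \<in> ?V" "\<And>k. ?N (\<lambda>z. poly p z - g k z) < d + 1 / real (Suc k)" by metis
  define h where "h k z = poly p z - g k z" for k z
  have h: "h k holomorphic_on UNIV" "h k \<in> L2_functions complex_gaussian" for k
    unfolding h_def[abs_def] using span_exponentials_entire_L2[OF g(1)]
    by (auto intro!: holomorphic_intros L2_functions_diff poly_L2)
  have hd: "?N (h k) < d + 1 / real (Suc k)" for k using g(2)[of k] by (simp add: h_def[abs_def])
  have cauchy: "?N (\<lambda>z. h j z - h k z) \<le> 2 / real (Suc j) + 2 / real (Suc k)" for j k
  proof -
    have "(\<lambda>z. (1/2) * (g j + g k) z) \<in> ?V"
      by (intro complex_functions.span_scale complex_functions.span_add g)
    from d_le[OF this] have "d \<le> ?N (\<lambda>z. (h j z + h k z) / 2)"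
      by (simp add: h_def field_simps)
    then show ?thesis
      unfolding integral_parallelogram[OF h(2) h(2)] using hd[of j] hd[of k] by linarith
  qed
  have "(\<lambda>k. 2 / real (Suc k)) \<longlonglongrightarrow> 0" by real_asymp
  from entire_L2_Cauchy_limit[OF h cauchy this] obtain f where
    f: "f holomorphic_on UNIV" "f \<in> L2_functions complex_gaussian" "\<And>z. (\<lambda>k. h k z) \<longlonglongrightarrow> f z"
       "\<And>j. ?N (\<lambda>z. h j z - f z) \<le> 2 / real (Suc j)" by blast
  have "f l = 0" if "l \<in> A" for l
  proof -
    have "(cmod (h k l))\<^sup>2 \<le> exp ((cmod l)\<^sup>2) * (1 / real (Suc k))" for k
    proof -
      let ?c = "h k l * exp (- of_real ((cmod l)\<^sup>2))"
      have "(\<lambda>z. exp (cnj l * z)) \<in> exponentials A" using that by (auto simp: exponentials_def)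
      then have "g k + (\<lambda>z. ?c * exp (cnj l * z)) \<in> ?V"
        by (intro complex_functions.span_add g complex_functions.span_scale complex_functions.span_base)
      from d_le[OF this] have "d \<le> ?N (\<lambda>z. h k z - ?c * exp (cnj l * z))"
        by (simp add: h_def algebra_simps)
      also have "\<dots> = ?N (h k) - exp (- (cmod l)\<^sup>2) * (cmod (h k l))\<^sup>2"
        by (rule integral_remove_kernel[OF h])
      finally have "exp (- (cmod l)\<^sup>2) * (cmod (h k l))\<^sup>2 \<le> 1 / real (Suc k)" using hd[of k] by linarith
      then show ?thesis by (simp add: exp_minus field_simps)
    qed
    moreover have "(\<lambda>k. exp ((cmod l)\<^sup>2) * (1 / real (Suc k))) \<longlonglongrightarrow> 0" by real_asymp
    moreover have "(\<lambda>k. (cmod (h k l))\<^sup>2) \<longlonglongrightarrow> (cmod (f l))\<^sup>2" by (intro tendsto_intros f)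
    ultimately have "(cmod (f l))\<^sup>2 \<le> 0" by (intro LIMSEQ_le[of "\<lambda>k. (cmod (h k l))\<^sup>2"]) auto
    then show ?thesis by simp
  qed
  then have "f = (\<lambda>z. 0)" using uniq f by blast
  then have small: "?N (h j) \<le> 2 / real (Suc j)" for j using f(4)[of j] by simp
  show ?thesis
    unfolding L2_closure_iff
  proof (intro conjI allI impI poly_L2)
    fix \<epsilon> :: real assume "\<epsilon> > 0"
    from order_tendstoD(2)[OF \<open>(\<lambda>k. 2 / real (Suc k)) \<longlonglongrightarrow> 0\<close> this] obtain j where "2 / real (Suc j) < \<epsilon>"
      by (auto simp: eventually_sequentially)
    then have "?N (\<lambda>z. poly p z - g j z) < \<epsilon>" using small[of j] by (simp add: h_def[abs_def])
    then show "\<exists>v\<in>?V \<inter> L2_functions complex_gaussian. ?N (\<lambda>z. poly p z - v z) < \<epsilon>"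
      using g(1) span_exponentials_entire_L2(2)[OF g(1)] by blast
  qed
qed

lemma spans_fock_bargmann_if_uniqueness:
  assumes "\<And>f. f holomorphic_on UNIV \<Longrightarrow> f \<in> L2_functions complex_gaussian \<Longrightarrow> (\<And>l. l \<in> A \<Longrightarrow> f l = 0) \<Longrightarrow> f = (\<lambda>z. 0)"
  shows "spans_fock_bargmann (exponentials A)"
  unfolding spans_fock_bargmann_def fock_bargmann_def
proof (rule equalityI)
  show "L2_closure complex_gaussian (complex_functions.span (exponentials A)) \<subseteq> L2_closure complex_gaussian (range poly)"
    by (rule L2_closure_mono_closure[OF span_exponentials_subset_closure_poly])
  show "L2_closure complex_gaussian (range poly) \<subseteq> L2_closure complex_gaussian (complex_functions.span (exponentials A))"
    using poly_in_closure_span_exponentials[OF assms] by (intro L2_closure_mono_closure) blast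
qed

theorem theorem1p2:
  fixes M :: "'w measure" and \<Lambda> :: "'w \<Rightarrow> complex set"
  assumes "ginibre_ensemble M \<Lambda>"
  shows "(AE \<omega> in M. spans_fock_bargmann (exponentials (\<Lambda> \<omega>))) \<and>
         (AE \<omega> in M. \<forall>f \<in> fock_bargmann_entire. (\<forall>l \<in> \<Lambda> \<omega>. f l = 0) \<longrightarrow> f = (\<lambda>z. 0))"
proof -
  interpret ginibre M \<Lambda> by unfold_locales (rule assms)
  show ?thesis
  proof
    show "AE \<omega> in M. spans_fock_bargmann (exponentials (\<Lambda> \<omega>))"
      using AE_uniqueness
    proof eventually_elim
      case (elim \<omega>)
      then show ?case by (intro spans_fock_bargmann_if_uniqueness) blast
    qed
    show "AE \<omega> in M. \<forall>f \<in> fock_bargmann_entire. (\<forall>l \<in> \<Lambda> \<omega>. f l = 0) \<longrightarrow> f = (\<lambda>z. 0)"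
      using AE_uniqueness
    proof eventually_elim
      case (elim \<omega>)
      then show ?case
        by (auto simp: fock_bargmann_entire_def fock_bargmann_def L2_closure_def)
    qed
  qed
qed

end
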